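(* Let $G$ be a finite group, let $p$ be a prime dividing $|G|$, and let $P$ be a Sylow $p$-subgroup of $G$. Assume that for every Sylow $p$-subgroup $Q$ of $G$ such that $P\cap Q$ is a tame intersection and $Z^*(P)<P\cap Q<P$ (strict inclusions), the group $N_G(P\cap Q)$ is $p$-nilpotent. Then $N_G(P)$ controls $p$-transfer in $G$.
   Context: All groups are finite. $Z^*(P)=\bigcap_{H\le P}N_P(H)$ denotes the norm of $P$ (the intersection of the normalizers in $P$ of all subgroups of $P$). A group is $p$-nilpotent if it has a normal Hall $p'$-subgroup (a normal $p$-complement). For Sylow $p$-subgroups $P,Q$ of $G$ (possibly $P=Q$), $P\cap Q$ is called a tame intersection if both $N_P(P\cap Q)$ and $N_Q(P\cap Q)$ are Sylow $p$-subgroups of $N_G(P\cap Q)$. $A^p(G)$ denotes the smallest normal subgroup of $G$ whose quotient is an abelian $p$-group. If $N\le G$ has index coprime to $p$, then $N$ controls $p$-transfer in $G$ if $N/A^p(N)\cong G/A^p(G)$. *)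

theory Defs
  imports "HOL-Algebra.Group_Action" "HOL-Algebra.Sylow"
begin

text \<open>
  A subgroup \<open>H\<close> of \<open>G\<close> is regarded as a group in its own right as \<open>G\<lparr>carrier := H\<rparr>\<close>;
  thus \<open>N\<^sub>P(H)\<close> is \<open>normalizer (G\<lparr>carrier := P\<rparr>) H\<close>. All notions below are meant for finite
  groups and a prime \<open>p\<close>.
\<close>

definition sylow_subgroup :: "('a, 'b) monoid_scheme \<Rightarrow> nat \<Rightarrow> 'a set \<Rightarrow> bool" where
  "sylow_subgroup G p P \<longleftrightarrow> subgroup P G \<and> card P = p ^ multiplicity p (order G)"

definition group_norm :: "('a, 'b) monoid_scheme \<Rightarrow> 'a set" where
  "group_norm G = (\<Inter>H \<in> {H. subgroup H G}. normalizer G H)"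

definition p_group :: "nat \<Rightarrow> ('a, 'b) monoid_scheme \<Rightarrow> bool" where
  "p_group p G \<longleftrightarrow> group G \<and> (\<exists>k. order G = p ^ k)"

text \<open>A Hall \<open>p'\<close>-subgroup is one of order prime to \<open>p\<close> whose index is a power of \<open>p\<close>.\<close>

definition p_nilpotent :: "nat \<Rightarrow> ('a, 'b) monoid_scheme \<Rightarrow> bool" where
  "p_nilpotent p G \<longleftrightarrow>
     (\<exists>K. K \<lhd> G \<and> coprime (card K) p \<and> (\<exists>k. card (rcosets\<^bsub>G\<^esub> K) = p ^ k))"

text \<open>The subgroups \<open>P\<close> and \<open>Q\<close> are understood to be Sylow \<open>p\<close>-subgroups of \<open>G\<close>.\<close>

definition tame_intersection ::
    "('a, 'b) monoid_scheme \<Rightarrow> nat \<Rightarrow> 'a set \<Rightarrow> 'a set \<Rightarrow> bool" where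
  "tame_intersection G p P Q \<longleftrightarrow>
     (let D = P \<inter> Q; N = G\<lparr>carrier := normalizer G D\<rparr> in
        sylow_subgroup N p (normalizer (G\<lparr>carrier := P\<rparr>) D) \<and>
        sylow_subgroup N p (normalizer (G\<lparr>carrier := Q\<rparr>) D))"

text \<open>\<open>A\<^sup>p(G)\<close>: the \<open>LEAST\<close> is with respect to inclusion. It exists by \<open>Ap_least\<close> below.\<close>

definition Ap :: "nat \<Rightarrow> ('a, 'b) monoid_scheme \<Rightarrow> 'a set" where
  "Ap p G = (LEAST N. N \<lhd> G \<and> comm_group (G Mod N) \<and> p_group p (G Mod N))"

definition controls_p_transfer ::
    "('a, 'b) monoid_scheme \<Rightarrow> nat \<Rightarrow> 'a set \<Rightarrow> bool" where
  "controls_p_transfer G p N \<longleftrightarrow>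
     subgroup N G \<and> coprime (card (rcosets\<^bsub>G\<^esub> N)) p \<and>
     (G\<lparr>carrier := N\<rparr> Mod Ap p (G\<lparr>carrier := N\<rparr>)) \<cong> (G Mod Ap p G)"

lemma (in group) p_abelian_quotient_Int:
  assumes p: "prime p"
    and N: "N \<lhd> G" "comm_group (G Mod N)" "p_group p (G Mod N)"
    and M: "M \<lhd> G" "comm_group (G Mod M)" "p_group p (G Mod M)"
  shows "N \<inter> M \<lhd> G \<and> comm_group (G Mod (N \<inter> M)) \<and> p_group p (G Mod (N \<inter> M))"
proof -
  interpret N: normal N G by fact
  interpret M: normal M G by fact
  interpret CN: comm_group "G Mod N" by fact
  interpret CM: comm_group "G Mod M" by fact
  let ?D = "(G Mod N) \<times>\<times> (G Mod M)"
  let ?h = "\<lambda>x. (N #> x, M #> x)"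
  have gD: "group ?D" by (intro DirProd_group CN.is_group CM.is_group)
  then interpret D: group ?D .
  have cD: "x \<otimes>\<^bsub>?D\<^esub> y = y \<otimes>\<^bsub>?D\<^esub> x" if "x \<in> carrier ?D" "y \<in> carrier ?D" for x y
    using that CN.m_comm CM.m_comm by (auto simp: mult_DirProd' simp del: mult_FactGroup)
  have h: "?h \<in> hom G ?D"
    using N.r_coset_hom_Mod M.r_coset_hom_Mod hom_paired by blast
  let ?I = "?D\<lparr>carrier := ?h ` carrier G\<rparr>"
  interpret h0: group_hom G ?D ?h
    by (simp add: group_hom_def group_hom_axioms_def h gD)
  have subI: "subgroup (?h ` carrier G) ?D" by (rule h0.img_is_subgroup)
  have gI: "group ?I" by (rule subgroup.subgroup_is_group[OF subI gD])
  have hI: "?h \<in> hom G ?I" using h by (auto simp: hom_def)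
  interpret h: group_hom G ?I ?h
    using hI gI by (simp add: group_hom_def group_hom_axioms_def)
  have "kernel G ?I ?h = N \<inter> M"
  proof -
    have "N #> x = N \<longleftrightarrow> x \<in> N" "M #> x = M \<longleftrightarrow> x \<in> M" if "x \<in> carrier G" for x
      using that N.rcos_const M.rcos_const rcos_self[OF that] N.subgroup_axioms M.subgroup_axioms
      by auto
    then show ?thesis
      using N.subset by (auto simp: kernel_def)
  qed
  moreover have "(G Mod kernel G ?I ?h) \<cong> ?I" by (rule h.FactGroup_iso) simp
  ultimately have iso: "(G Mod (N \<inter> M)) \<cong> ?I" and nrm: "N \<inter> M \<lhd> G"
    using h.normal_kernel by auto
  have gQ: "group (G Mod (N \<inter> M))" using nrm by (rule normal.factorgroup_is_group)
  have cI: "comm_group ?I"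
  proof (rule group.group_comm_groupI[OF gI])
    fix x y assume "x \<in> carrier ?I" "y \<in> carrier ?I"
    then have "x \<in> carrier ?D" "y \<in> carrier ?D" using subgroup.subset[OF subI] by auto
    from cD[OF this] show "x \<otimes>\<^bsub>?I\<^esub> y = y \<otimes>\<^bsub>?I\<^esub> x" by simp
  qed
  have "?I \<cong> (G Mod (N \<inter> M))"
    using iso gQ group.iso_sym by blast
  then have "comm_group (G Mod (N \<inter> M))"
    by (rule comm_group.iso_imp_comm_group[OF cI _ group.is_monoid[OF gQ]])
  moreover have "p_group p (G Mod (N \<inter> M))"
  proof -
    obtain j k where "order (G Mod N) = p ^ j" "order (G Mod M) = p ^ k"
      using N(3) M(3) by (auto simp: p_group_def)
    then have o: "order ?D = p ^ (j + k)"
      by (simp add: order_def card_cartesian_product power_add)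
    have "card (?h ` carrier G) dvd order ?D"
      by (rule dvdI[where k = "card (rcosets\<^bsub>?D\<^esub> (?h ` carrier G))"])
        (simp only: D.lagrange[OF subI, symmetric] mult.commute)
    then have "\<exists>i. card (?h ` carrier G) = p ^ i"
      unfolding o using divides_primepow_nat[OF p] by blast
    then show ?thesis
      using gQ iso_same_card[OF iso] by (simp add: p_group_def order_def)
  qed
  ultimately show ?thesis using nrm by simp
qed

lemma (in group) Ap_least:
  assumes fin: "finite (carrier G)" and p: "prime p"
  shows "Ap p G \<lhd> G" "comm_group (G Mod Ap p G)" "p_group p (G Mod Ap p G)"
    and "\<And>N. \<lbrakk>N \<lhd> G; comm_group (G Mod N); p_group p (G Mod N)\<rbrakk> \<Longrightarrow> Ap p G \<subseteq> N"
proof -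
  let ?P = "\<lambda>N. N \<lhd> G \<and> comm_group (G Mod N) \<and> p_group p (G Mod N)"
  have top: "?P (carrier G)"
  proof -
    have n: "carrier G \<lhd> G" by (simp add: normal_inv_iff subgroup_self)
    have g: "group (G Mod carrier G)" using n by (rule normal.factorgroup_is_group)
    have "carrier (G Mod carrier G) = {carrier G}"
      using normal.fact_group_trivial_iff[OF n fin] by simp
    then have "comm_group (G Mod carrier G)" "order (G Mod carrier G) = p ^ 0"
      using g by (auto intro!: group.group_comm_groupI simp: order_def)
    then show ?thesis using n g unfolding p_group_def by blast
  qed
  have fS: "finite (Collect ?P)"
    by (rule finite_subset[of _ "Pow (carrier G)"])
      (auto simp: fin dest: normal_imp_subgroup subgroup.subset)
  have "?P (\<Inter>F)" if "finite F" "F \<noteq> {}" "F \<subseteq> Collect ?P" for F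
    using that
  proof (induction F rule: finite_ne_induct)
    case (insert N F)
    then show ?case using p_abelian_quotient_Int[OF p, of N "\<Inter>F"] by simp
  qed simp
  then have I: "?P (\<Inter>(Collect ?P))" using fS top by blast
  then have "Ap p G = \<Inter>(Collect ?P)"
    unfolding Ap_def by (intro Least_equality) auto
  with I show "Ap p G \<lhd> G" "comm_group (G Mod Ap p G)" "p_group p (G Mod Ap p G)"
    and "\<And>N. \<lbrakk>N \<lhd> G; comm_group (G Mod N); p_group p (G Mod N)\<rbrakk> \<Longrightarrow> Ap p G \<subseteq> N"
    by auto
qed

end

theory Submission
  imports Defs "HOL-Algebra.Multiplicative_Group" "HOL-Number_Theory.Residues"
begin

text \<open>
  Write \<open>N = N\<^sub>G(P)\<close> and let \<open>Z\<close> be the norm of \<open>P\<close>.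

  \<^emph>\<open>Reduction to a character.\<close> The map \<open>N \<rightarrow> G/A\<^sup>p(G)\<close> is onto, because the index of \<open>N\<close> is prime to
  \<open>p\<close>, and its kernel \<open>N \<inter> A\<^sup>p(G)\<close> contains \<open>A\<^sup>p(N)\<close>; so control of transfer means that the two are equal.
  If they differ, \<open>N/A\<^sup>p(N)\<close> is larger than \<open>G/A\<^sup>p(G)\<close>, and as the transfer \<open>G \<rightarrow> N/A\<^sup>p(N)\<close> factors
  through \<open>G/A\<^sup>p(G)\<close>, it is not onto. Dividing \<open>N/A\<^sup>p(N)\<close> by a subgroup of index \<open>p\<close> that contains its image
  gives a nonzero character \<open>\<nu>\<close> from \<open>N\<close> to the integers modulo \<open>p\<close> whose transfer to \<open>G\<close> is zero
  (\<open>character_with_trivial_transfer\<close>).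

  \<^emph>\<open>Evaluation.\<close> The cosets of \<open>N\<close> correspond to the Sylow subgroups. For \<open>Q = t P t\<^sup>-\<^sup>1\<close> put
  \<open>\<nu>\<^sub>Q(u) = \<nu>(t\<^sup>-\<^sup>1 u t)\<close>. Choose \<open>y \<in> P\<close> of least order with \<open>\<nu>(y) \<noteq> 0\<close>. A cycle of \<open>y\<close> of length
  \<open>r > 1\<close> on the Sylow subgroups contributes the value of \<open>\<nu>\<close> at a conjugate of \<open>y\<^sup>r\<close>, which is zero by the choice
  of \<open>y\<close>. Hence the sum of \<open>\<nu>\<^sub>Q(y)\<close> over all \<open>Q\<close> containing \<open>y\<close> is zero (\<open>transfer_at_minimal\<close>).

  \<^emph>\<open>The role of the norm.\<close> An element of \<open>Z\<close> normalizes the subgroup generated by \<open>y\<close>, and acts on it by an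
  exponent congruent to 1 modulo \<open>p\<close>. So \<open>\<nu>\<^sub>Q(y)\<close> is constant on the orbits of \<open>Z\<close>, and only those \<open>Q\<close>
  count that contain both \<open>y\<close> and \<open>Z\<close> (\<open>sum_restricts_to_norm\<close>). The number of these is congruent to 1 modulo
  \<open>p\<close>. If \<open>Z < P \<inter> Q\<close>, then \<open>Q\<close> is conjugate to \<open>P\<close> by an element that centralizes \<open>P \<inter> Q\<close>
  (\<open>sylow_conjugate_in_centralizer\<close>; only here the hypothesis on tame intersections enters), and so
  \<open>\<nu>\<^sub>Q(y) = \<nu>(y)\<close>. The \<open>Q\<close> with \<open>P \<inter> Q = Z < P\<close> matter only if \<open>y \<in> Z\<close>; they fall into cycles of length \<open>p\<close> under an
  element \<open>w \<in> P - Z\<close> with \<open>w\<^sup>p \<in> Z\<close>, and each cycle contributes zero (\<open>sum_over_meeting_in_norm\<close>).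
  Altogether the sum is \<open>\<nu>(y)\<close>, which contradicts the choice of \<open>y\<close>.
\<close>

section \<open>Fixed points of \<open>p\<close>-groups\<close>

lemma cong_sum_nontrivial_classes:
  fixes f :: "'x \<Rightarrow> int" and m :: int
  assumes fin: "finite X"
    and self: "\<And>x. x \<in> X \<Longrightarrow> x \<in> cls x" and sub: "\<And>x. x \<in> X \<Longrightarrow> cls x \<subseteq> X"
    and cls: "\<And>x y. x \<in> X \<Longrightarrow> y \<in> cls x \<Longrightarrow> cls y = cls x"
    and zero: "\<And>x. x \<in> X \<Longrightarrow> cls x \<noteq> {x} \<Longrightarrow> [sum f (cls x) = 0] (mod m)"
  shows "[sum f X = sum f {x \<in> X. cls x = {x}}] (mod m)"
proof -
  define Y where "Y = {x \<in> X. cls x \<noteq> {x}}"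
  have sY: "cls x \<subseteq> Y" if "x \<in> Y" for x
  proof
    fix y assume y: "y \<in> cls x"
    have "x \<in> X" "cls x \<noteq> {x}" using that by (auto simp: Y_def)
    then have "y \<in> X" "cls y = cls x" "x \<in> cls y" using y sub[of x] cls[of x y] self[of x] by auto
    then show "y \<in> Y" using \<open>cls x \<noteq> {x}\<close> unfolding Y_def by auto
  qed
  have U: "\<Union>(cls ` Y) = Y"
  proof
    show "Y \<subseteq> \<Union>(cls ` Y)" using self by (auto simp: Y_def)
  qed (use sY in auto)
  have "sum f Y = sum f (\<Union>(cls ` Y))" using U by simp
  also have "\<dots> = sum (sum f) (cls ` Y)"
  proof (rule sum.Union_disjoint[unfolded comp_def])
    show "\<forall>C\<in>cls ` Y. finite C"
    proof
      fix C assume "C \<in> cls ` Y"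
      then have "C \<subseteq> Y" using sY by auto
      then show "finite C" using fin unfolding Y_def by (auto intro: finite_subset)
    qed
    show "\<forall>C\<in>cls ` Y. \<forall>D\<in>cls ` Y. C \<noteq> D \<longrightarrow> C \<inter> D = {}"
    proof (intro ballI impI, rule ccontr)
      fix C D assume "C \<in> cls ` Y" "D \<in> cls ` Y" "C \<noteq> D" "C \<inter> D \<noteq> {}"
      then obtain x y z where "x \<in> X" "y \<in> X" "C = cls x" "D = cls y" "z \<in> cls x" "z \<in> cls y"
        unfolding Y_def by auto
      then show False using cls[of x z] cls[of y z] \<open>C \<noteq> D\<close> by simp
    qed
  qed
  finally have eq: "sum f Y = sum (sum f) (cls ` Y)" .
  have "m dvd sum (sum f) (cls ` Y)"
    by (rule dvd_sum) (use zero in \<open>auto simp: Y_def cong_0_iff\<close>)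
  then have 1: "m dvd sum f Y" using eq by simp
  have "X = {x \<in> X. cls x = {x}} \<union> Y" unfolding Y_def by blast
  then have "sum f X = sum f {x \<in> X. cls x = {x}} + sum f Y"
    using fin by (subst sum.union_disjoint[symmetric]) (auto simp: Y_def)
  then show ?thesis using 1 by (simp add: cong_iff_dvd_diff)
qed

lemma (in group) card_orbit_dvd_order:
  assumes clo: "\<And>g x. g \<in> carrier G \<Longrightarrow> x \<in> X \<Longrightarrow> act g x \<in> X"
    and one: "\<And>x. x \<in> X \<Longrightarrow> act \<one> x = x"
    and mult: "\<And>g h x. g \<in> carrier G \<Longrightarrow> h \<in> carrier G \<Longrightarrow> x \<in> X \<Longrightarrow> act (g \<otimes> h) x = act g (act h x)"
    and x: "x \<in> X"
  shows "card ((\<lambda>g. act g x) ` carrier G) dvd order G"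
proof -
  let ?\<phi> = "\<lambda>g. restrict (act g) X"
  have bij: "?\<phi> g \<in> Bij X" if g: "g \<in> carrier G" for g
  proof -
    have "bij_betw (act g) X X"
      by (rule bij_betwI[where g = "act (inv g)"])
        (use g clo one in \<open>auto simp: Pi_iff mult[symmetric]\<close>)
    then have "bij_betw (?\<phi> g) X X" by simp
    then show ?thesis by (simp add: Bij_def)
  qed
  have "?\<phi> \<in> hom G (BijGroup X)"
  proof (rule homI)
    fix g h assume "g \<in> carrier G" "h \<in> carrier G"
    then show "?\<phi> (g \<otimes> h) = ?\<phi> g \<otimes>\<^bsub>BijGroup X\<^esub> ?\<phi> h"
      using bij clo by (auto simp: BijGroup_def compose_def mult fun_eq_iff)
  qed (use bij in \<open>simp add: BijGroup_def\<close>)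
  then have "group_action G X ?\<phi>"
    using group_BijGroup by (simp add: group_action_def group_hom_def group_hom_axioms_def)
  then have "card (orbit G ?\<phi> x) * card (stabilizer G ?\<phi> x) = order G"
    using group_action.orbit_stabilizer_theorem x by fast
  moreover have "orbit G ?\<phi> x = (\<lambda>g. act g x) ` carrier G"
    using x by (auto simp: orbit_def)
  ultimately show ?thesis by (metis dvd_triv_left)
qed

text \<open>
  The usual congruence between the size of a set and the number of fixed points of a \<open>p\<close>-group, weighted by
  an invariant function. The weights are needed for the values of characters; weight 1 gives the counting
  arguments of Sylow theory.
\<close>

lemma (in group) cong_sum_fixed_points:
  fixes f :: "'x \<Rightarrow> int"
  assumes p: "prime p" and A: "subgroup A G" "card A = p ^ k" and fin: "finite X"
    and clo: "\<And>g x. g \<in> A \<Longrightarrow> x \<in> X \<Longrightarrow> act g x \<in> X"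
    and one: "\<And>x. x \<in> X \<Longrightarrow> act \<one> x = x"
    and mult: "\<And>g h x. g \<in> A \<Longrightarrow> h \<in> A \<Longrightarrow> x \<in> X \<Longrightarrow> act (g \<otimes> h) x = act g (act h x)"
    and inv: "\<And>g x. g \<in> A \<Longrightarrow> x \<in> X \<Longrightarrow> [f (act g x) = f x] (mod int p)"
  shows "[sum f X = sum f {x \<in> X. \<forall>g\<in>A. act g x = x}] (mod int p)"
proof -
  interpret A: group "G\<lparr>carrier := A\<rparr>" using A(1) by (rule subgroup_imp_group)
  let ?cls = "\<lambda>x. (\<lambda>g. act g x) ` A"
  have oneA: "\<one> \<in> A" using A(1) by (rule subgroup.one_closed)
  have fix_iff: "?cls x = {x} \<longleftrightarrow> (\<forall>g\<in>A. act g x = x)" if "x \<in> X" for x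
  proof -
    have "?cls x \<noteq> {}" using oneA by blast
    then have "?cls x = {x} \<longleftrightarrow> (\<forall>y\<in>?cls x. y = x)" by (metis insertI1 singletonD set_eq_subset subsetI subset_singletonD)
    then show ?thesis by simp
  qed
  have "[sum f X = sum f {x \<in> X. ?cls x = {x}}] (mod int p)"
  proof (rule cong_sum_nontrivial_classes[OF fin])
    fix x assume x: "x \<in> X"
    show "x \<in> ?cls x" using oneA one[OF x] by force
    show "?cls x \<subseteq> X" using clo x by blast
    have in_cls: "?cls (act g x) = ?cls x" if g: "g \<in> A" for g
    proof -
      have "act h (act g x) \<in> ?cls x" if "h \<in> A" for h
        using that g x A(1) by (auto simp: mult[symmetric] subgroup.m_closed)
      moreover have "act h x \<in> ?cls (act g x)" if h: "h \<in> A" for h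
      proof -
        have gc: "g \<in> carrier G" "h \<in> carrier G" using A(1) g h subgroup.subset by blast+
        have m: "h \<otimes> inv g \<in> A" using A(1) g h by (simp add: subgroup.m_closed subgroup.m_inv_closed)
        have "act (h \<otimes> inv g) (act g x) = act h x"
          using m g x gc by (simp add: mult[symmetric] m_assoc)
        then show ?thesis using m by (metis imageI)
      qed
      ultimately show ?thesis by blast
    qed
    show "?cls y = ?cls x" if "y \<in> ?cls x" for y using that in_cls by blast
    assume nt: "?cls x \<noteq> {x}"
    have "card (?cls x) dvd p ^ k"
      using A.card_orbit_dvd_order[of X act x] clo one mult x A(2) by (simp add: order_def)
    moreover have "card (?cls x) \<noteq> 1"
      using nt oneA one[OF x] by (metis card_1_singletonE imageI singletonD)
    ultimately have pd: "p dvd card (?cls x)"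
      using p by (metis divides_primepow_nat dvd_power gr0I power_0)
    have "[sum f (?cls x) = sum (\<lambda>_. f x) (?cls x)] (mod int p)"
      by (rule cong_sum) (use inv x in auto)
    then show "[sum f (?cls x) = 0] (mod int p)"
      using pd by (auto simp: cong_0_iff cong_dvd_iff)
  qed
  then show ?thesis using fix_iff by (simp cong: conj_cong)
qed

section \<open>Conjugation\<close>

text \<open>
  The structure is an argument because the same conjugation occurs in \<open>G\<close> and in its subgroups.
  The conjugate of a set \<open>H\<close> is the image \<open>cnj G g ` H\<close>.
\<close>

definition cnj :: "('a, 'b) monoid_scheme \<Rightarrow> 'a \<Rightarrow> 'a \<Rightarrow> 'a" where
  "cnj G g x = g \<otimes>\<^bsub>G\<^esub> x \<otimes>\<^bsub>G\<^esub> inv\<^bsub>G\<^esub> g"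

context group
begin

lemma inv_cancel_left [simp]:
  "\<lbrakk>x \<in> carrier G; y \<in> carrier G\<rbrakk> \<Longrightarrow> x \<otimes> (inv x \<otimes> y) = y"
  "\<lbrakk>x \<in> carrier G; y \<in> carrier G\<rbrakk> \<Longrightarrow> inv x \<otimes> (x \<otimes> y) = y"
  by (simp_all add: m_assoc[symmetric])

lemma cnj_closed [simp]: "\<lbrakk>g \<in> carrier G; x \<in> carrier G\<rbrakk> \<Longrightarrow> cnj G g x \<in> carrier G"
  by (simp add: cnj_def)

lemma cnj_one [simp]: "x \<in> carrier G \<Longrightarrow> cnj G \<one> x = x"
  by (simp add: cnj_def)

lemma cnj_cnj: "\<lbrakk>g \<in> carrier G; h \<in> carrier G; x \<in> carrier G\<rbrakk> \<Longrightarrow> cnj G (g \<otimes> h) x = cnj G g (cnj G h x)"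
  by (simp add: cnj_def m_assoc inv_mult_group)

lemma cnj_mult: "\<lbrakk>g \<in> carrier G; x \<in> carrier G; y \<in> carrier G\<rbrakk> \<Longrightarrow> cnj G g (x \<otimes> y) = cnj G g x \<otimes> cnj G g y"
  by (simp add: cnj_def m_assoc)

lemma cnj_hom: "g \<in> carrier G \<Longrightarrow> cnj G g \<in> hom G G"
  by (simp add: hom_def cnj_mult)

lemma cnj_group_hom: "g \<in> carrier G \<Longrightarrow> group_hom G G (cnj G g)"
  by (simp add: group_hom_def group_hom_axioms_def cnj_hom)

lemma cnj_pow: "\<lbrakk>g \<in> carrier G; x \<in> carrier G\<rbrakk> \<Longrightarrow> cnj G g (x [^] (n::nat)) = cnj G g x [^] n"
  using group_hom.hom_nat_pow[OF cnj_group_hom] by blast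

lemma cnj_cancel [simp]:
  "\<lbrakk>g \<in> carrier G; x \<in> carrier G\<rbrakk> \<Longrightarrow> cnj G g (cnj G (inv g) x) = x"
  "\<lbrakk>g \<in> carrier G; x \<in> carrier G\<rbrakk> \<Longrightarrow> cnj G (inv g) (cnj G g x) = x"
  by (simp_all add: cnj_cnj[symmetric])

lemma inj_on_cnj: "g \<in> carrier G \<Longrightarrow> H \<subseteq> carrier G \<Longrightarrow> inj_on (cnj G g) H"
  by (rule inj_on_inverseI[where g = "cnj G (inv g)"]) auto

lemma conj_mult: "\<lbrakk>g \<in> carrier G; h \<in> carrier G; H \<subseteq> carrier G\<rbrakk> \<Longrightarrow> cnj G (g \<otimes> h) ` H = cnj G g ` cnj G h ` H"
  unfolding image_image by (rule image_cong) (auto simp: cnj_cnj)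

lemma conj_one [simp]: "H \<subseteq> carrier G \<Longrightarrow> cnj G \<one> ` H = H"
  by (simp add: subset_iff)

lemma conj_subset: "\<lbrakk>g \<in> carrier G; H \<subseteq> carrier G\<rbrakk> \<Longrightarrow> cnj G g ` H \<subseteq> carrier G"
  by auto

lemma conj_inv_cancel [simp]:
  assumes "g \<in> carrier G" "H \<subseteq> carrier G"
  shows "cnj G (inv g) ` cnj G g ` H = H" "cnj G g ` cnj G (inv g) ` H = H"
  using assms conj_mult[of "inv g" g H] conj_mult[of g "inv g" H] by simp_all

lemma mem_conj_iff:
  "\<lbrakk>g \<in> carrier G; H \<subseteq> carrier G; x \<in> carrier G\<rbrakk> \<Longrightarrow> x \<in> cnj G g ` H \<longleftrightarrow> cnj G (inv g) x \<in> H"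
proof -
  assume a: "g \<in> carrier G" "H \<subseteq> carrier G" "x \<in> carrier G"
  then have "x \<in> cnj G g ` H" if "cnj G (inv g) x \<in> H" using that by (metis cnj_cancel(1) imageI)
  moreover have "cnj G (inv g) x \<in> H" if "x \<in> cnj G g ` H" using that a by auto
  ultimately show ?thesis by blast
qed

lemma conj_subgroup: "\<lbrakk>g \<in> carrier G; subgroup H G\<rbrakk> \<Longrightarrow> subgroup (cnj G g ` H) G"
  using group_hom.subgroup_img_is_subgroup[OF cnj_group_hom] by blast

lemma card_conj: "\<lbrakk>g \<in> carrier G; H \<subseteq> carrier G\<rbrakk> \<Longrightarrow> card (cnj G g ` H) = card H"
  by (rule card_image) (rule inj_on_cnj)

lemma conj_Int: "\<lbrakk>g \<in> carrier G; H \<subseteq> carrier G; K \<subseteq> carrier G\<rbrakk> \<Longrightarrow> cnj G g ` (H \<inter> K) = cnj G g ` H \<inter> cnj G g ` K"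
  by (rule inj_on_image_Int[OF inj_on_cnj[OF _ subset_refl]])

lemma conj_self: "\<lbrakk>subgroup H G; h \<in> H\<rbrakk> \<Longrightarrow> cnj G h ` H = H"
proof -
  assume H: "subgroup H G" and h: "h \<in> H"
  then have c: "H \<subseteq> carrier G" "h \<in> carrier G" using subgroup.subset by auto
  have s: "cnj G g ` H \<subseteq> H" if "g \<in> H" for g
    using that H by (auto simp: cnj_def subgroup.m_closed subgroup.m_inv_closed)
  have "cnj G h ` cnj G (inv h) ` H \<subseteq> cnj G h ` H"
    using s[of "inv h"] H h by (auto simp: subgroup.m_inv_closed)
  then show ?thesis using s[OF h] c by simp
qed

lemma conj_eq_coset: "\<lbrakk>g \<in> carrier G; H \<subseteq> carrier G\<rbrakk> \<Longrightarrow> g <# H #> inv g = cnj G g ` H"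
  by (auto simp: cnj_def l_coset_def r_coset_def image_iff)

lemma subgroup_nat_pow_closed: "\<lbrakk>subgroup H G; x \<in> H\<rbrakk> \<Longrightarrow> x [^] (n::nat) \<in> H"
  by (induction n) (auto intro: subgroup.one_closed subgroup.m_closed)

lemma normalizer_eq: "H \<subseteq> carrier G \<Longrightarrow> normalizer G H = {g \<in> carrier G. cnj G g ` H = H}"
  unfolding normalizer_def stabilizer_def by (auto simp: conj_eq_coset)

lemma normalizer_subgroup: "H \<subseteq> carrier G \<Longrightarrow> subgroup (normalizer G H) G"
proof -
  assume H: "H \<subseteq> carrier G"
  show ?thesis
  proof (rule subgroupI)
    show "normalizer G H \<noteq> {}" using H by (auto simp: normalizer_eq intro!: exI[of _ \<one>])
    fix a assume a: "a \<in> normalizer G H"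
    then have c: "a \<in> carrier G" "cnj G a ` H = H" using H by (simp_all add: normalizer_eq)
    then show "inv a \<in> normalizer G H" using conj_inv_cancel(1)[of a H] H by (simp add: normalizer_eq)
  qed (use H in \<open>auto simp: normalizer_eq conj_mult\<close>)
qed

lemma cnj_consistent:
  assumes "subgroup N G" "g \<in> N" shows "cnj (G\<lparr>carrier := N\<rparr>) g x = cnj G g x"
  using assms by (simp add: cnj_def m_inv_consistent)

lemma normalizer_consistent:
  assumes N: "subgroup N G" and H: "H \<subseteq> N"
  shows "normalizer (G\<lparr>carrier := N\<rparr>) H = N \<inter> normalizer G H"
proof -
  interpret N: group "G\<lparr>carrier := N\<rparr>" using N by (rule subgroup_imp_group)
  have Nc: "N \<subseteq> carrier G" using N by (rule subgroup.subset)
  have "normalizer (G\<lparr>carrier := N\<rparr>) H = {g \<in> N. cnj (G\<lparr>carrier := N\<rparr>) g ` H = H}"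
    using N.normalizer_eq H by simp
  also have "\<dots> = {g \<in> N. cnj G g ` H = H}"
    using N by (auto simp: cnj_consistent)
  also have "\<dots> = N \<inter> normalizer G H"
    using Nc H by (auto simp: normalizer_eq)
  finally show ?thesis .
qed

end

section \<open>\<open>p\<close>-subgroups and Sylow subgroups\<close>

context group
begin

lemma rcoset_eq_iff:
  assumes K: "subgroup K G" and "a \<in> carrier G" "b \<in> carrier G"
  shows "K #> a = K #> b \<longleftrightarrow> a \<otimes> inv b \<in> K"
proof
  have c: "a \<otimes> inv b \<in> carrier G" "K \<subseteq> carrier G" using assms subgroup.subset by auto
  show "a \<otimes> inv b \<in> K" if "K #> a = K #> b"
    using coset_join1[OF coset_mult_inv2[OF that assms(2,3) c(2)] c(1) K] .
  show "K #> a = K #> b" if "a \<otimes> inv b \<in> K"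
    using coset_mult_inv1[OF coset_join2[OF c(1) K that] assms(2,3) c(2)] .
qed

lemma card_rcosets_in_subgroup:
  assumes fin: "finite (carrier G)" and N: "subgroup N G" and K: "subgroup K G" "K \<subseteq> N"
  shows "card ((\<lambda>g. K #> g) ` N) * card K = card N"
proof -
  interpret N: group "G\<lparr>carrier := N\<rparr>" using N by (rule subgroup_imp_group)
  have "subgroup K (G\<lparr>carrier := N\<rparr>)" using K N by (simp add: subgroup_incl)
  from N.lagrange[OF this] have "card (rcosets\<^bsub>G\<lparr>carrier := N\<rparr>\<^esub> K) * card K = card N"
    by (simp add: order_def mult.commute)
  moreover have "rcosets\<^bsub>G\<lparr>carrier := N\<rparr>\<^esub> K = (\<lambda>g. K #> g) ` N"
    by (auto simp: RCOSETS_def)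
  ultimately show ?thesis by simp
qed

lemma card_subgroup_dvd:
  assumes "finite (carrier G)" "subgroup N G" "subgroup K G" "K \<subseteq> N"
  shows "card K dvd card N"
  using card_rcosets_in_subgroup[OF assms] by (metis dvd_triv_right)

text \<open>
  \<open>H\<close> acts on the right cosets of \<open>K\<close> in \<open>N\<close>, and the coset of \<open>g\<close> is fixed iff \<open>g H g\<^sup>-\<^sup>1\<close> lies in \<open>K\<close>.
  This one count yields both the conjugacy of Sylow subgroups and the growth of normalizers.
\<close>

lemma cong_card_fixed_rcosets:
  assumes fin: "finite (carrier G)" and p: "prime p"
    and N: "subgroup N G" and K: "subgroup K G" "K \<subseteq> N"
    and H: "subgroup H G" "H \<subseteq> N" "card H = p ^ k"
  shows "[int (card {C. \<exists>g\<in>N. C = K #> g \<and> H \<subseteq> cnj G (inv g) ` K}) = int (card N div card K)] (mod int p)"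
proof -
  let ?X = "(\<lambda>g. K #> g) ` N"
  let ?act = "\<lambda>h C. C #> inv h"
  have Nc: "N \<subseteq> carrier G" and Kc: "K \<subseteq> carrier G" and Hc: "H \<subseteq> carrier G"
    using N K H subgroup.subset by blast+
  have act: "?act h (K #> g) = K #> (g \<otimes> inv h)" if "g \<in> N" "h \<in> H" for g h
    using that Nc Kc Hc by (simp add: coset_mult_assoc subset_iff)
  have "finite N" using fin Nc finite_subset by blast
  have "[(\<Sum>C\<in>?X. 1) = (\<Sum>C\<in>{C\<in>?X. \<forall>h\<in>H. ?act h C = C}. (1::int))] (mod int p)"
  proof (rule cong_sum_fixed_points[OF p H(1) H(3)])
    show "finite ?X" using \<open>finite N\<close> by simp
    fix h C assume h: "h \<in> H" and "C \<in> ?X"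
    then obtain g where g: "g \<in> N" "C = K #> g" by blast
    have "g \<otimes> inv h \<in> N" using g h H N by (auto intro!: subgroup.m_closed subgroup.m_inv_closed)
    then show "?act h C \<in> ?X" using act g h by blast
  next
    fix C assume "C \<in> ?X"
    then show "?act \<one> C = C" using Nc Kc by (auto simp: coset_mult_assoc subset_iff)
  next
    fix h h' C assume "h \<in> H" "h' \<in> H" "C \<in> ?X"
    then show "?act (h \<otimes> h') C = ?act h (?act h' C)"
      using Nc Kc Hc by (auto simp: coset_mult_assoc subset_iff inv_mult_group m_assoc)
  qed simp
  moreover have "{C\<in>?X. \<forall>h\<in>H. ?act h C = C} = {C. \<exists>g\<in>N. C = K #> g \<and> H \<subseteq> cnj G (inv g) ` K}"
  proof -
    have "(\<forall>h\<in>H. ?act h (K #> g) = K #> g) \<longleftrightarrow> H \<subseteq> cnj G (inv g) ` K" if g: "g \<in> N" for g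
    proof -
      have gc: "g \<in> carrier G" using g Nc by blast
      have "?act h (K #> g) = K #> g \<longleftrightarrow> h \<in> cnj G (inv g) ` K" if h: "h \<in> H" for h
      proof -
        have hc: "h \<in> carrier G" using h Hc by blast
        have "?act h (K #> g) = K #> g \<longleftrightarrow> K #> g = K #> (g \<otimes> inv h)" using act[OF g h] by auto
        also have "\<dots> \<longleftrightarrow> cnj G g h \<in> K"
          using gc hc K by (simp add: rcoset_eq_iff cnj_def inv_mult_group m_assoc)
        also have "\<dots> \<longleftrightarrow> h \<in> cnj G (inv g) ` K" using gc hc Kc by (simp add: mem_conj_iff)
        finally show ?thesis .
      qed
      then show ?thesis by blast
    qed
    then show ?thesis by blast
  qed
  moreover have "card ?X = card N div card K"
  proof -
    have "finite K" using K(2) \<open>finite N\<close> finite_subset by auto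
    moreover have "K \<noteq> {}" using subgroup.one_closed[OF K(1)] by auto
    ultimately have "card K \<noteq> 0" by simp
    then show ?thesis by (simp flip: card_rcosets_in_subgroup[OF fin N K])
  qed
  ultimately show ?thesis by (simp add: cong_sym_eq)
qed

lemma p_subgroup_in_conj:
  assumes fin: "finite (carrier G)" and p: "prime p"
    and N: "subgroup N G" and K: "subgroup K G" "K \<subseteq> N" "\<not> p dvd card N div card K"
    and H: "subgroup H G" "H \<subseteq> N" "card H = p ^ k"
  obtains g where "g \<in> N" "H \<subseteq> cnj G g ` K"
proof -
  let ?F = "{C. \<exists>g\<in>N. C = K #> g \<and> H \<subseteq> cnj G (inv g) ` K}"
  have "\<not> p dvd card ?F"
    using cong_dvd_iff[OF cong_card_fixed_rcosets[OF fin p N K(1,2) H]] K(3) by simp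
  then have "card ?F \<noteq> 0" by (intro notI) simp
  then have "?F \<noteq> {}" by (intro notI) simp
  then obtain g where "g \<in> N" "H \<subseteq> cnj G (inv g) ` K" by blast
  then show thesis using that[of "inv g"] N by (simp add: subgroup.m_inv_closed)
qed

text \<open>
  Let \<open>D\<close> act on its own cosets in \<open>P\<close>: their number is divisible by \<open>p\<close> and the trivial coset is fixed, so
  there is another fixed coset, and its elements normalize \<open>D\<close>.
\<close>

lemma normalizers_grow:
  assumes fin: "finite (carrier G)" and p: "prime p"
    and P: "subgroup P G" "card P = p ^ k" and D: "subgroup D G" "D \<subset> P"
  obtains g where "g \<in> P" "g \<notin> D" "cnj G g ` D = D"
proof -
  have Pc: "P \<subseteq> carrier G" using P subgroup.subset by blast
  have finP: "finite P" using Pc fin finite_subset by blast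
  have DP: "D \<subseteq> P" and Dc: "D \<subseteq> carrier G" using D Pc by auto
  obtain j where j: "card D = p ^ j" "j \<le> k"
    using card_subgroup_dvd[OF fin P(1) D(1) DP] P(2) p by (metis divides_primepow_nat)
  have "card D < card P" using D(2) finP by (rule psubset_card_mono[rotated])
  then have "j < k" using j P(2) by (metis less_irrefl le_neq_implies_less)
  then have "card P div card D = p ^ (k - j)"
    using j P(2) p by (simp add: power_diff prime_gt_0_nat)
  then have "p dvd card P div card D" using \<open>j < k\<close> by (simp add: dvd_power)
  let ?F = "{C. \<exists>g\<in>P. C = D #> g \<and> D \<subseteq> cnj G (inv g) ` D}"
  have pF: "p dvd card ?F"
    using cong_dvd_iff[OF cong_card_fixed_rcosets[OF fin p P(1) D(1) DP D(1) DP j(1)]] \<open>p dvd card P div card D\<close>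
    by simp
  have "\<one> \<in> P" using P(1) by (rule subgroup.one_closed)
  then have DF: "D \<in> ?F" using Dc by (auto intro!: bexI[of _ \<one>])
  have "?F \<noteq> {D}"
  proof
    assume "?F = {D}"
    then have "card ?F = 1" by simp
    then show False using pF p by (metis nat_dvd_1_iff_1 not_prime_1)
  qed
  then obtain C where "C \<in> ?F" "C \<noteq> D" using DF by blast
  then obtain g where g: "g \<in> P" "D #> g \<noteq> D" "D \<subseteq> cnj G (inv g) ` D" by blast
  have gc: "g \<in> carrier G" using g Pc by blast
  have "cnj G (inv g) ` D = D"
    using g(3) card_conj[of "inv g" D] gc Dc fin
    by (metis card_subset_eq finite_subset conj_subset inv_closed)
  moreover have "g \<notin> D" using g(2) gc D(1) coset_join2 by blast
  then have "inv g \<notin> D" using D(1) gc by (metis inv_inv subgroup.m_inv_closed)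
  moreover have "inv g \<in> P" using g P by (simp add: subgroup.m_inv_closed)
  ultimately show thesis using that by blast
qed

end

locale finite_group_prime = group G for G (structure) +
  fixes p :: nat
  assumes fin [simp]: "finite (carrier G)" and p: "prime p"
begin

abbreviation "Syl \<equiv> {Q. sylow_subgroup G p Q}"

lemma sylow_subgroupD:
  assumes "sylow_subgroup G p Q"
  shows "subgroup Q G" "Q \<subseteq> carrier G" "finite Q" "card Q = p ^ multiplicity p (order G)"
proof -
  show Q: "subgroup Q G" "Q \<subseteq> carrier G" "card Q = p ^ multiplicity p (order G)"
    using assms subgroup.subset[of Q G] by (auto simp: sylow_subgroup_def)
  show "finite Q" using Q fin finite_subset by blast
qed

lemma finite_Syl: "finite Syl"
  by (rule finite_subset[of _ "Pow (carrier G)"]) (auto dest!: sylow_subgroupD(2))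

lemma sylow_conj: "\<lbrakk>sylow_subgroup G p Q; g \<in> carrier G\<rbrakk> \<Longrightarrow> sylow_subgroup G p (cnj G g ` Q)"
  using conj_subgroup[of g Q] card_conj[OF _ sylow_subgroupD(2)] by (simp add: sylow_subgroup_def)

lemma not_dvd_div_multiplicity:
  assumes "n > 0" shows "\<not> p dvd n div p ^ multiplicity p n"
  using multiplicity_decompose[of n p] assms p by (metis not_gr0 not_prime_unit)

lemma card_p_subgroup:
  assumes "sylow_subgroup G p Q" "subgroup H G" "H \<subseteq> Q"
  obtains k where "card H = p ^ k"
  using card_subgroup_dvd[OF fin sylow_subgroupD(1)[OF assms(1)] assms(2,3)] sylow_subgroupD(4)[OF assms(1)]
    divides_primepow_nat[OF p] by metis

lemma sylow_contains_conj:
  assumes Q: "sylow_subgroup G p Q" and H: "subgroup H G" "card H = p ^ k"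
  obtains g where "g \<in> carrier G" "H \<subseteq> cnj G g ` Q"
proof -
  have "\<not> p dvd card (carrier G) div card Q"
    using not_dvd_div_multiplicity[of "order G"] sylow_subgroupD(4)[OF Q] order_gt_0_iff_finite
    by (simp add: order_def)
  then show thesis
    using p_subgroup_in_conj[OF fin p subgroup_self sylow_subgroupD(1)[OF Q] sylow_subgroupD(2)[OF Q] _
        H(1) subgroup.subset[OF H(1)] H(2)] that by blast
qed

lemma sylow_conjugate:
  assumes P: "sylow_subgroup G p P" and Q: "sylow_subgroup G p Q"
  obtains g where "g \<in> carrier G" "Q = cnj G g ` P"
proof -
  obtain g where g: "g \<in> carrier G" "Q \<subseteq> cnj G g ` P"
    using sylow_contains_conj[OF P sylow_subgroupD(1)[OF Q] sylow_subgroupD(4)[OF Q]] by blast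
  then have "Q = cnj G g ` P"
    using sylow_subgroupD[OF sylow_conj[OF P g(1)]] sylow_subgroupD[OF Q] by (simp add: card_subset_eq)
  with g show thesis using that by blast
qed

text \<open>
  \<open>Q\<close> is a normal Sylow subgroup of its normalizer, so it contains every \<open>p\<close>-subgroup of it.
\<close>

lemma p_subgroup_normalizing_sylow:
  assumes Q: "sylow_subgroup G p Q" and H: "subgroup H G" "card H = p ^ k"
    and n: "\<And>h. h \<in> H \<Longrightarrow> cnj G h ` Q = Q"
  shows "H \<subseteq> Q"
proof -
  note Q' = sylow_subgroupD[OF Q]
  let ?N = "normalizer G Q"
  have N: "subgroup ?N G" and N_eq: "?N = {g \<in> carrier G. cnj G g ` Q = Q}"
    using normalizer_subgroup normalizer_eq Q'(2) by auto
  have QN: "Q \<subseteq> ?N"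
  proof
    fix x assume "x \<in> Q"
    then show "x \<in> ?N" using Q'(2) conj_self[OF Q'(1)] unfolding N_eq by blast
  qed
  have HN: "H \<subseteq> ?N" using n subgroup.subset[OF H(1)] by (auto simp: N_eq)
  have Nc: "?N \<subseteq> carrier G" using N_eq by blast
  have "\<not> p dvd card ?N div card Q"
  proof
    assume "p dvd card ?N div card Q"
    moreover have "card ?N div card Q dvd card (carrier G) div card Q"
      using card_subgroup_dvd[OF fin subgroup_self N Nc] card_subgroup_dvd[OF fin N Q'(1) QN]
      by (auto simp: div_dvd_div)
    ultimately show False
      using not_dvd_div_multiplicity[of "order G"] Q'(4) order_gt_0_iff_finite
      by (metis dvd_trans fin order_def)
  qed
  then obtain g where "g \<in> ?N" "H \<subseteq> cnj G g ` Q"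
    using p_subgroup_in_conj[OF fin p N Q'(1) QN _ H(1) HN H(2)] by blast
  then show ?thesis by (simp add: N_eq)
qed

text \<open>
  The subgroup generated by \<open>S\<close> is a \<open>p\<close>-group and fixes exactly the Sylow subgroups that contain it, so their
  number is congruent to that of all Sylow subgroups. The choice \<open>S = P\<close> shows that this is 1.
\<close>

lemma card_Syl_containing:
  assumes P: "sylow_subgroup G p P" and S: "S \<subseteq> P"
  shows "[int (card {Q \<in> Syl. S \<subseteq> Q}) = 1] (mod int p)"
proof -
  note P' = sylow_subgroupD[OF P]
  have count: "[(\<Sum>Q\<in>Syl. 1) = (\<Sum>Q\<in>{Q\<in>Syl. H \<subseteq> Q}. (1::int))] (mod int p)"
    if H: "subgroup H G" "H \<subseteq> P" for H
  proof -
    obtain k where k: "card H = p ^ k" using card_p_subgroup[OF P H] by blast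
    have Hc: "H \<subseteq> carrier G" using H subgroup.subset by blast
    have "[(\<Sum>Q\<in>Syl. 1) = (\<Sum>Q\<in>{Q\<in>Syl. \<forall>h\<in>H. cnj G h ` Q = Q}. (1::int))] (mod int p)"
      by (rule cong_sum_fixed_points[OF p H(1) k finite_Syl])
        (simp_all add: sylow_conj subsetD[OF Hc] conj_mult[OF _ _ sylow_subgroupD(2)] conj_one[OF sylow_subgroupD(2)])
    moreover have "{Q\<in>Syl. \<forall>h\<in>H. cnj G h ` Q = Q} = {Q\<in>Syl. H \<subseteq> Q}"
    proof (rule Collect_cong, rule conj_cong[OF refl])
      fix Q assume "Q \<in> Syl"
      then have Q: "sylow_subgroup G p Q" by simp
      show "(\<forall>h\<in>H. cnj G h ` Q = Q) \<longleftrightarrow> H \<subseteq> Q"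
        using p_subgroup_normalizing_sylow[OF Q H(1) k] conj_self[OF sylow_subgroupD(1)[OF Q]]
        by (meson subset_iff)
    qed
    ultimately show ?thesis by simp
  qed
  have "{Q\<in>Syl. P \<subseteq> Q} = {P}"
  proof -
    have "Q = P" if "sylow_subgroup G p Q" "P \<subseteq> Q" for Q
      using card_subset_eq[OF sylow_subgroupD(3)[OF that(1)] that(2)] sylow_subgroupD(4)[OF that(1)] P'(4) by simp
    then show ?thesis using P by blast
  qed
  then have 1: "[(\<Sum>Q\<in>Syl. 1) = (1::int)] (mod int p)"
    using count[OF P'(1)] by simp
  let ?H = "generate G S"
  have Sc: "S \<subseteq> carrier G" using S P' by blast
  have H: "subgroup ?H G" using generate_is_subgroup[OF Sc] .
  have iff: "?H \<subseteq> Q \<longleftrightarrow> S \<subseteq> Q" if "subgroup Q G" for Q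
    using generate_subgroup_incl[OF _ that] generate.incl[of _ S G] by blast
  have eq: "{Q\<in>Syl. ?H \<subseteq> Q} = {Q\<in>Syl. S \<subseteq> Q}"
    by (rule Collect_cong, rule conj_cong[OF refl]) (simp add: iff sylow_subgroupD(1))
  have "?H \<subseteq> P" using iff[OF P'(1)] S by simp
  from cong_trans[OF cong_sym[OF count[OF H this]] 1] show ?thesis
    by (simp only: eq) simp
qed

lemma generate_powers: "u \<in> carrier G \<Longrightarrow> generate G {u} = {u [^] (k::nat) | k. True}"
  using generate_pow_on_finite_carrier[OF fin] by simp

lemma ord_in_sylow:
  assumes "sylow_subgroup G p Q" "u \<in> Q"
  obtains k where "ord u = p ^ k"
proof -
  have u: "u \<in> carrier G" using assms sylow_subgroupD(2) by blast
  have "generate G {u} \<subseteq> Q" using generate_subgroup_incl[OF _ sylow_subgroupD(1)[OF assms(1)]] assms(2) by simp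
  then show thesis
    using card_p_subgroup[OF assms(1) generate_is_subgroup, of "{u}"] u generate_pow_card[OF u] that by auto
qed

lemma conj_pow_fixed:
  assumes "g \<in> carrier G" "Q \<subseteq> carrier G" "cnj G g ` Q = Q"
  shows "cnj G (g [^] (n::nat)) ` Q = Q"
proof (induction n)
  case (Suc n)
  have "cnj G (g [^] n \<otimes> g) ` Q = cnj G (g [^] n) ` cnj G g ` Q"
    using assms by (intro conj_mult) auto
  then show ?case using Suc assms(3) by simp
qed (use assms in simp)

lemma p_element_normalizing_sylow:
  assumes Q: "sylow_subgroup G p Q" and u: "u \<in> carrier G" "ord u = p ^ k" "cnj G u ` Q = Q"
  shows "u \<in> Q"
proof -
  have "generate G {u} \<subseteq> Q"
  proof (rule p_subgroup_normalizing_sylow[OF Q])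
    show "subgroup (generate G {u}) G" using u by (intro generate_is_subgroup) auto
    show "card (generate G {u}) = p ^ k" using generate_pow_card[OF u(1)] u(2) by simp
    fix h assume "h \<in> generate G {u}"
    then show "cnj G h ` Q = Q"
      using generate_powers[OF u(1)] conj_pow_fixed[OF u(1) sylow_subgroupD(2)[OF Q] u(3)] by auto
  qed
  then show ?thesis using generate.incl[of u "{u}" G] by blast
qed

end

section \<open>Fusion along Sylow intersections\<close>

lemma (in group) coprime_card_Int_trivial:
  assumes fin: "finite (carrier G)" and A: "subgroup A G" and B: "subgroup B G"
    and cop: "coprime (card A) (card B)"
  shows "A \<inter> B = {\<one>}"
proof -
  have AB: "subgroup (A \<inter> B) G" using A B by (rule subgroups_Inter_pair)
  have "card (A \<inter> B) dvd card A" "card (A \<inter> B) dvd card B"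
    using card_subgroup_dvd[OF fin _ AB] A B by auto
  then have "card (A \<inter> B) = 1"
    using cop by (metis coprime_common_divisor_nat)
  then obtain x where "A \<inter> B = {x}" by (rule card_1_singletonE)
  then show ?thesis using subgroup.one_closed[OF AB] by auto
qed

context finite_group_prime
begin

text \<open>
  The normal \<open>p\<close>-complement \<open>K\<close> of the normalizer of \<open>D\<close> satisfies \<open>[K, D] \<subseteq> K \<inter> D = 1\<close>, and by order it
  is complemented by the Sylow subgroup \<open>S\<close>.
\<close>

lemma p_nilpotent_normalizer_factor:
  assumes D: "subgroup D G" "card D = p ^ j"
    and nil: "p_nilpotent p (G\<lparr>carrier := normalizer G D\<rparr>)"
    and S: "subgroup S G" "S \<subseteq> normalizer G D" "card S = p ^ multiplicity p (card (normalizer G D))"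
    and n: "n \<in> normalizer G D"
  obtains k s where "k \<in> carrier G" "s \<in> S" "n = k \<otimes> s" "\<And>d. d \<in> D \<Longrightarrow> cnj G k d = d"
proof -
  define N where "N = normalizer G D"
  have Dc: "D \<subseteq> carrier G" using D(1) by (rule subgroup.subset)
  have N: "subgroup N G" and N_eq: "N = {g \<in> carrier G. cnj G g ` D = D}"
    unfolding N_def using normalizer_subgroup[OF Dc] normalizer_eq[OF Dc] by auto
  have Nc: "N \<subseteq> carrier G" using N by (rule subgroup.subset)
  have finN: "finite N" using Nc fin by (rule finite_subset)
  interpret N: group "G\<lparr>carrier := N\<rparr>" using N by (rule subgroup_imp_group)
  obtain K m where K: "K \<lhd> G\<lparr>carrier := N\<rparr>" "coprime (card K) p"
      and m: "card (rcosets\<^bsub>G\<lparr>carrier := N\<rparr>\<^esub> K) = p ^ m"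
    using nil unfolding p_nilpotent_def N_def by blast
  have KN: "subgroup K (G\<lparr>carrier := N\<rparr>)" using K(1) by (rule normal_imp_subgroup)
  have Ks: "subgroup K G" using incl_subgroup[OF N KN] .
  have Ksub: "K \<subseteq> N" using subgroup.subset[OF KN] by simp
  have Sc: "S \<subseteq> carrier G" and Kc: "K \<subseteq> carrier G" using S Ks subgroup.subset by blast+
  have cardN: "card N = p ^ m * card K"
    using N.lagrange[OF KN] m by (simp add: order_def)
  have "\<not> p dvd card K"
    using K(2) p by (metis coprime_commute coprime_absorb_left not_prime_unit)
  then have "multiplicity p (card N) = m"
    unfolding cardN using p by (intro multiplicity_eqI) (auto simp: mult.commute)
  then have cS: "card S = p ^ m" using S(3) by (simp add: N_def)
  have KS: "K \<inter> S = {\<one>}"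
    by (rule coprime_card_Int_trivial[OF fin Ks S(1)]) (simp add: cS K(2))
  have "inj_on (\<lambda>(k, s). k \<otimes> s) (K \<times> S)"
  proof (rule inj_onI, clarify)
    fix k s k' s' assume a: "k \<in> K" "s \<in> S" "k' \<in> K" "s' \<in> S" "k \<otimes> s = k' \<otimes> s'"
    then have c: "k \<in> carrier G" "s \<in> carrier G" "k' \<in> carrier G" "s' \<in> carrier G" using Kc Sc by auto
    have e: "inv k' \<otimes> k = s' \<otimes> inv s"
    proof -
      have "inv k' \<otimes> k = inv k' \<otimes> (k \<otimes> s) \<otimes> inv s" using c by (simp add: m_assoc)
      also have "\<dots> = s' \<otimes> inv s" using c unfolding a(5) by (simp add: m_assoc)
      finally show ?thesis .
    qed
    have "inv k' \<otimes> k \<in> K" using a Ks by (simp add: subgroup.m_closed subgroup.m_inv_closed)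
    moreover have "s' \<otimes> inv s \<in> S" using a S by (simp add: subgroup.m_closed subgroup.m_inv_closed)
    ultimately have one: "inv k' \<otimes> k = \<one>" "s' \<otimes> inv s = \<one>" using KS e by auto
    have "k = k' \<otimes> (inv k' \<otimes> k)" using c by simp
    then have "k = k'" unfolding one using c by simp
    moreover have "s' = (s' \<otimes> inv s) \<otimes> s" using c by (simp add: m_assoc)
    then have "s = s'" unfolding one using c by simp
    ultimately show "k = k' \<and> s = s'" by blast
  qed
  then have "card ((\<lambda>(k, s). k \<otimes> s) ` (K \<times> S)) = card N"
    by (simp add: card_image card_cartesian_product cS cardN)
  moreover have "(\<lambda>(k, s). k \<otimes> s) ` (K \<times> S) \<subseteq> N"
    using Ksub S(2) N by (auto simp: N_def[symmetric] intro: subgroup.m_closed)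
  ultimately have "(\<lambda>(k, s). k \<otimes> s) ` (K \<times> S) = N"
    using finN by (simp add: card_subset_eq)
  then have "n \<in> (\<lambda>(k, s). k \<otimes> s) ` (K \<times> S)" using n by (simp add: N_def)
  then obtain k s where ks: "k \<in> K" "s \<in> S" "n = k \<otimes> s" by auto
  have DN: "D \<subseteq> N"
  proof
    fix d assume "d \<in> D"
    then show "d \<in> N" using Dc conj_self[OF D(1)] unfolding N_eq by blast
  qed
  have KD: "K \<inter> D = {\<one>}"
    by (rule coprime_card_Int_trivial[OF fin Ks D(1)]) (simp add: D(2) K(2))
  have "cnj G k d = d" if d: "d \<in> D" for d
  proof -
    have c: "k \<in> carrier G" "d \<in> carrier G" "d \<in> N" "k \<in> N" using ks d Kc Dc DN Ksub by auto
    have "cnj G k ` D = D" using c by (simp add: N_eq)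
    then have "cnj G k d \<in> D" using d by blast
    then have 1: "cnj G k d \<otimes> inv d \<in> D" using d D(1) by (simp add: subgroup.m_closed subgroup.m_inv_closed)
    have "cnj G d (inv k) \<in> K"
      using normal.inv_op_closed2[OF K(1), of d "inv k"] c ks Ks N
      by (simp add: cnj_def subgroup.m_inv_closed m_inv_consistent)
    then have "k \<otimes> cnj G d (inv k) \<in> K" using ks Ks by (simp add: subgroup.m_closed)
    moreover have "k \<otimes> cnj G d (inv k) = cnj G k d \<otimes> inv d" using c by (simp add: cnj_def m_assoc)
    ultimately have "cnj G k d \<otimes> inv d = \<one>" using 1 KD by auto
    moreover have "cnj G k d = cnj G k d \<otimes> inv d \<otimes> d" using c by (simp add: m_assoc)
    ultimately show ?thesis using c by simp
  qed
  moreover have "k \<in> carrier G" using ks(1) Kc by blast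
  ultimately show thesis using that ks by blast
qed

lemma normalizer_in_sylow_grows:
  assumes P: "sylow_subgroup G p P" and D: "subgroup D G" "D \<subset> P"
  shows "subgroup (P \<inter> normalizer G D) G" "D \<subset> P \<inter> normalizer G D"
proof -
  have Dc: "D \<subseteq> carrier G" using D(1) by (rule subgroup.subset)
  note Neq = normalizer_eq[OF Dc]
  show "subgroup (P \<inter> normalizer G D) G"
    using sylow_subgroupD(1)[OF P] normalizer_subgroup[OF Dc] by (rule subgroups_Inter_pair)
  obtain g where "g \<in> P" "g \<notin> D" "cnj G g ` D = D"
    using normalizers_grow[OF fin p sylow_subgroupD(1,4)[OF P] D] .
  moreover have "D \<subseteq> normalizer G D" unfolding Neq using Dc conj_self[OF D(1)] by blast
  ultimately show "D \<subset> P \<inter> normalizer G D"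
    unfolding Neq using D(2) sylow_subgroupD(2)[OF P] by blast
qed

text \<open>
  This is the part of Alperin's fusion theorem that is needed here, by induction on the index of \<open>D = P \<inter> Q\<close>
  in \<open>P\<close>. Let \<open>N = N\<^sub>G(D)\<close>. Comparing \<open>P\<close> with a Sylow subgroup \<open>R\<close> that contains a Sylow subgroup of \<open>N\<close>
  above \<open>N\<^sub>P(D)\<close>, the induction hypothesis shows that \<open>N\<^sub>P(D)\<close> is itself Sylow in \<open>N\<close>. Then an element of \<open>N\<close>
  carries \<open>N\<^sub>Q(D)\<close> into \<open>N\<^sub>P(D)\<close>, and a second application of the induction hypothesis gives \<open>h \<in> N\<close> with
  \<open>Q = h P h\<^sup>-\<^sup>1\<close>. Thus \<open>N\<^sub>Q(D)\<close> is also Sylow in \<open>N\<close>, so the intersection \<open>D\<close> is tame and \<open>N\<close> is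
  \<open>p\<close>-nilpotent; therefore \<open>h\<close> can be replaced by its component in the \<open>p\<close>-complement, which centralizes \<open>D\<close>.

  The set \<open>Z\<close> may be arbitrary, because every intersection met in the induction contains \<open>D\<close> and hence \<open>Z\<close>.
\<close>

lemma sylow_conjugate_in_centralizer:
  assumes P: "sylow_subgroup G p P"
    and nil: "\<And>Q. \<lbrakk>sylow_subgroup G p Q; tame_intersection G p P Q; Z \<subset> P \<inter> Q; P \<inter> Q \<subset> P\<rbrakk>
           \<Longrightarrow> p_nilpotent p (G\<lparr>carrier := normalizer G (P \<inter> Q)\<rparr>)"
    and "sylow_subgroup G p Q" "Z \<subset> P \<inter> Q"
  shows "\<exists>c\<in>carrier G. (\<forall>d\<in>P \<inter> Q. cnj G c d = d) \<and> Q = cnj G c ` P"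
  using assms(3,4)
proof (induction "card P - card (P \<inter> Q)" arbitrary: Q rule: less_induct)
  case less
  note P' = sylow_subgroupD[OF P]
  note Q = less.prems(1)
  note Q' = sylow_subgroupD[OF Q]
  define D where "D = P \<inter> Q"
  have IH: "\<exists>c\<in>carrier G. (\<forall>d\<in>P \<inter> R. cnj G c d = d) \<and> R = cnj G c ` P"
    if R: "sylow_subgroup G p R" "Z \<subset> P \<inter> R" "card D < card (P \<inter> R)" for R
  proof (rule less.hyps)
    have "card (P \<inter> R) \<le> card P" using P'(3) by (rule card_mono) blast
    then show "card P - card (P \<inter> R) < card P - card (P \<inter> Q)" using R(3) by (simp add: D_def)
  qed (use R in auto)
  show ?case
  proof (cases "D = P")
    case True
    then have "P \<subseteq> Q" unfolding D_def by blast
    then have "Q = P" using card_subset_eq[OF Q'(3), of P] P'(4) Q'(4) by simp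
    then show ?thesis using P' by (intro bexI[of _ \<one>]) auto
  next
    case False
    then have DP: "D \<subset> P" unfolding D_def by blast
    have DQ: "D \<subset> Q"
    proof -
      have "D \<noteq> Q" using DP P' Q' by (metis psubset_card_mono less_irrefl)
      then show ?thesis unfolding D_def by blast
    qed
    have ZD: "Z \<subset> D" using less.prems(2) by (simp add: D_def)
    have D: "subgroup D G" unfolding D_def using P'(1) Q'(1) by (rule subgroups_Inter_pair)
    have Dc: "D \<subseteq> carrier G" using D by (rule subgroup.subset)
    define N where "N = normalizer G D"
    have N: "subgroup N G" and N_eq: "N = {g \<in> carrier G. cnj G g ` D = D}"
      unfolding N_def using normalizer_subgroup[OF Dc] normalizer_eq[OF Dc] by auto
    have Nc: "N \<subseteq> carrier G" using N by (rule subgroup.subset)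
    have finN: "finite N" using Nc fin by (rule finite_subset)
    define m where "m = multiplicity p (card N)"
    note NP = normalizer_in_sylow_grows[OF P D DP, folded N_def]
    note NQ = normalizer_in_sylow_grows[OF Q D DQ, folded N_def]
    obtain i where i: "card (P \<inter> N) = p ^ i" using card_p_subgroup[OF P NP(1)] by auto
    obtain j where j: "card (Q \<inter> N) = p ^ j" using card_p_subgroup[OF Q NQ(1)] by auto
    obtain l where l: "card D = p ^ l" using card_p_subgroup[OF P D] DP by auto
    have cN: "c \<in> N" if "c \<in> carrier G" "\<forall>d\<in>E. cnj G c d = d" "D \<subseteq> E" for c E
      using that by (auto simp: N_eq subset_iff)
    have "card N > 0" using finN subgroup.one_closed[OF N] card_gt_0_iff by blast
    have index: "\<not> p dvd card N div p ^ m"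
      unfolding m_def using \<open>card N > 0\<close> by (rule not_dvd_div_multiplicity)

    \<comment> \<open>\<open>N\<^sub>P(D)\<close> is a Sylow subgroup of \<open>N\<close>.\<close>
    have cardNP: "card (P \<inter> N) = p ^ m"
    proof -
      have "order (G\<lparr>carrier := N\<rparr>) = p ^ m * (card N div p ^ m)"
        unfolding m_def by (simp add: order_def multiplicity_dvd)
      then obtain S0 where S0: "subgroup S0 (G\<lparr>carrier := N\<rparr>)" "card S0 = p ^ m"
        using sylow_thm[OF p subgroup_imp_group[OF N]] finN by auto
      have S0G: "subgroup S0 G" "S0 \<subseteq> N" using incl_subgroup[OF N S0(1)] subgroup.subset[OF S0(1)] by auto
      obtain g where g: "g \<in> N" "P \<inter> N \<subseteq> cnj G g ` S0"
        using p_subgroup_in_conj[OF fin p N S0G _ NP(1) _ i] index S0(2) by auto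
      define S where "S = cnj G g ` S0"
      have gc: "g \<in> carrier G" using g Nc by blast
      have S: "subgroup S G" unfolding S_def using gc S0G by (simp add: conj_subgroup)
      have "S \<subseteq> cnj G g ` N" unfolding S_def using S0G by blast
      then have SN: "S \<subseteq> N" using conj_self[OF N g(1)] by simp
      have cS: "card S = p ^ m" unfolding S_def using S0 S0G Nc gc by (simp add: card_conj)
      have finS: "finite S" using SN finN by (rule finite_subset)
      obtain h where h: "h \<in> carrier G" "S \<subseteq> cnj G h ` P"
        using sylow_contains_conj[OF P S cS] .
      let ?R = "cnj G h ` P"
      have R: "sylow_subgroup G p ?R" using P h(1) by (rule sylow_conj)
      have sub: "P \<inter> N \<subseteq> P \<inter> ?R" using g(2) h(2) unfolding S_def by blast
      then have "D \<subset> P \<inter> ?R" using NP(2) by blast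
      then have "card D < card (P \<inter> ?R)" "Z \<subset> P \<inter> ?R"
        using P' ZD by (auto intro: psubset_card_mono)
      then obtain c where c: "c \<in> carrier G" "\<forall>d\<in>P \<inter> ?R. cnj G c d = d" "?R = cnj G c ` P"
        using IH[OF R] by blast
      \<comment> \<open>Conjugation by the inverse of \<open>c\<close> moves \<open>S\<close> into \<open>P\<close> without leaving \<open>N\<close>.\<close>
      have "c \<in> N" using cN[OF c(1,2)] \<open>D \<subset> P \<inter> ?R\<close> by blast
      then have "inv c \<in> N" using N by (simp add: subgroup.m_inv_closed)
      have "cnj G (inv c) ` S \<subseteq> cnj G (inv c) ` N" using SN by blast
      then have "cnj G (inv c) ` S \<subseteq> N" using conj_self[OF N \<open>inv c \<in> N\<close>] by simp
      moreover have "cnj G (inv c) ` S \<subseteq> cnj G (inv c) ` cnj G c ` P" using h(2) c(3) by blast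
      then have "cnj G (inv c) ` S \<subseteq> P" using c(1) P'(2) by simp
      ultimately have "card (cnj G (inv c) ` S) \<le> card (P \<inter> N)"
        using P' by (intro card_mono) auto
      then have "p ^ m \<le> card (P \<inter> N)"
        using card_conj[of "inv c" S] c(1) subgroup.subset[OF S] cS by simp
      moreover have "card (P \<inter> N) \<le> p ^ m" using g(2) finS cS unfolding S_def by (metis card_mono)
      ultimately show ?thesis by simp
    qed

    obtain n where n: "n \<in> N" "Q \<inter> N \<subseteq> cnj G n ` (P \<inter> N)"
      using p_subgroup_in_conj[OF fin p N NP(1) _ _ NQ(1) _ j] cardNP index by auto
    have nc: "n \<in> carrier G" "inv n \<in> N" using n Nc N by (auto simp: subgroup.m_inv_closed)
    let ?Q = "cnj G (inv n) ` Q"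
    have SQ: "sylow_subgroup G p ?Q" using Q nc by (simp add: sylow_conj)
    have "cnj G (inv n) ` (Q \<inter> N) \<subseteq> cnj G (inv n) ` cnj G n ` (P \<inter> N)" using n(2) by blast
    also have "\<dots> = P \<inter> N" using nc P' by (intro conj_inv_cancel) auto
    finally have sub: "cnj G (inv n) ` (Q \<inter> N) \<subseteq> P \<inter> ?Q" by blast
    have "cnj G (inv n) ` D = D" using nc by (simp add: N_eq)
    then have DPQ: "D \<subseteq> P \<inter> ?Q" using sub NQ(2) by blast
    have "card D < card (Q \<inter> N)" using NQ(2) finN by (simp add: psubset_card_mono)
    also have "\<dots> = card (cnj G (inv n) ` (Q \<inter> N))" using nc Q' by (intro card_conj[symmetric]) auto
    also have "\<dots> \<le> card (P \<inter> ?Q)" using sub P' by (simp add: card_mono)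
    finally obtain c where c: "c \<in> carrier G" "\<forall>d\<in>P \<inter> ?Q. cnj G c d = d" "?Q = cnj G c ` P"
      using IH[OF SQ] ZD DPQ by blast
    have "c \<in> N" using cN[OF c(1,2) DPQ] .
    \<comment> \<open>\<open>h\<close> normalizes \<open>D\<close> and conjugates \<open>P\<close> to \<open>Q\<close>, hence \<open>N\<^sub>P(D)\<close> to \<open>N\<^sub>Q(D)\<close>.\<close>
    define h where "h = n \<otimes> c"
    have hN: "h \<in> N" unfolding h_def using n \<open>c \<in> N\<close> N by (simp add: subgroup.m_closed)
    have hc: "h \<in> carrier G" using hN Nc by blast
    have Qh: "Q = cnj G h ` P"
    proof -
      have "Q = cnj G n ` ?Q" using nc Q' by simp
      also have "\<dots> = cnj G n ` cnj G c ` P" by (simp only: c(3))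
      also have "\<dots> = cnj G h ` P" unfolding h_def by (rule conj_mult[OF nc(1) c(1) P'(2), symmetric])
      finally show ?thesis .
    qed
    have "cnj G h ` (P \<inter> N) = Q \<inter> N"
      using conj_Int[OF hc P'(2) Nc] conj_self[OF N hN] Qh by simp
    then have cardNQ: "card (Q \<inter> N) = p ^ m"
      using card_conj[of h "P \<inter> N"] hc Nc cardNP by auto
    have "tame_intersection G p P Q"
    proof -
      have "normalizer (G\<lparr>carrier := P\<rparr>) D = P \<inter> N" "normalizer (G\<lparr>carrier := Q\<rparr>) D = Q \<inter> N"
        using normalizer_consistent[OF P'(1)] normalizer_consistent[OF Q'(1)] DP DQ by (auto simp: N_def)
      moreover have "sylow_subgroup (G\<lparr>carrier := N\<rparr>) p (P \<inter> N)" "sylow_subgroup (G\<lparr>carrier := N\<rparr>) p (Q \<inter> N)"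
        unfolding sylow_subgroup_def
        using cardNP cardNQ subgroup_incl[OF NP(1) N] subgroup_incl[OF NQ(1) N] by (simp_all add: order_def m_def)
      ultimately show ?thesis
        unfolding tame_intersection_def Let_def D_def[symmetric] N_def[symmetric] by simp
    qed
    then have "p_nilpotent p (G\<lparr>carrier := normalizer G D\<rparr>)"
      using nil[OF Q] ZD DP by (simp add: D_def)
    then obtain k s where k: "k \<in> carrier G" "s \<in> P \<inter> N" "h = k \<otimes> s" "\<And>d. d \<in> D \<Longrightarrow> cnj G k d = d"
      using p_nilpotent_normalizer_factor[OF D l _ NP(1)[unfolded N_def]] cardNP hN
      unfolding N_def m_def by auto
    \<comment> \<open>The factor \<open>s\<close> of \<open>h\<close> lies in \<open>P\<close> and may be dropped.\<close>
    have "Q = cnj G k ` cnj G s ` P"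
      unfolding Qh k(3) using k P' by (intro conj_mult) auto
    then have "Q = cnj G k ` P" using conj_self[OF P'(1)] k(2) by simp
    then show ?thesis using k(1,4) unfolding D_def by blast
  qed
qed

end

section \<open>Additive characters modulo \<open>p\<close>\<close>

text \<open>
  A homomorphism to the cyclic group of order \<open>p\<close>, represented by integer values up to congruence, so that
  products over orbits become integer sums.
\<close>

definition additive_mod :: "nat \<Rightarrow> ('a, 'b) monoid_scheme \<Rightarrow> ('a \<Rightarrow> int) \<Rightarrow> bool" where
  "additive_mod p G \<nu> \<longleftrightarrow> (\<forall>x\<in>carrier G. \<forall>y\<in>carrier G. [\<nu> (x \<otimes>\<^bsub>G\<^esub> y) = \<nu> x + \<nu> y] (mod int p))"

lemma additive_modD:
  "\<lbrakk>additive_mod p G \<nu>; x \<in> carrier G; y \<in> carrier G\<rbrakk> \<Longrightarrow> [\<nu> (x \<otimes>\<^bsub>G\<^esub> y) = \<nu> x + \<nu> y] (mod int p)"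
  by (simp add: additive_mod_def)

lemma additive_mod_comp:
  assumes "additive_mod p H \<mu>" "\<theta> \<in> hom G H"
  shows "additive_mod p G (\<lambda>x. \<mu> (\<theta> x))"
  using assms by (auto simp: additive_mod_def hom_def Pi_iff)

context group
begin

lemma additive_mod_one:
  assumes "additive_mod p G \<nu>" shows "[\<nu> \<one> = 0] (mod int p)"
proof -
  have "[\<nu> \<one> + 0 = \<nu> \<one> + \<nu> \<one>] (mod int p)"
    using additive_modD[OF assms one_closed one_closed] by simp
  then have "[0 = \<nu> \<one>] (mod int p)" by (simp only: cong_add_lcancel)
  then show ?thesis by (rule cong_sym)
qed

lemma additive_mod_pow:
  assumes "additive_mod p G \<nu>" "x \<in> carrier G"
  shows "[\<nu> (x [^] (n::nat)) = int n * \<nu> x] (mod int p)"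
proof (induction n)
  case 0
  then show ?case using additive_mod_one[OF assms(1)] by simp
next
  case (Suc n)
  have "[\<nu> (x [^] n \<otimes> x) = \<nu> (x [^] n) + \<nu> x] (mod int p)"
    using assms by (intro additive_modD) auto
  also have "[\<nu> (x [^] n) + \<nu> x = int n * \<nu> x + \<nu> x] (mod int p)"
    using Suc by (intro cong_add) auto
  finally show ?case by (simp add: algebra_simps)
qed

text \<open>
  A discrete logarithm with respect to a generator.
\<close>

lemma prime_order_additive_mod:
  assumes p: "prime p" and o: "order G = p"
  obtains \<mu> where "additive_mod p G \<mu>" "\<And>x. x \<in> carrier G \<Longrightarrow> [\<mu> x = 0] (mod int p) \<longleftrightarrow> x = \<one>"
proof -
  have fin: "finite (carrier G)" using o p prime_gt_0_nat by (metis order_gt_0_iff_finite)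
  have "card (carrier G) > 1" using o p prime_gt_1_nat by (simp add: order_def)
  then obtain b where b: "b \<in> carrier G" "b \<noteq> \<one>"
    by (metis is_singletonI' is_singleton_altdef less_irrefl one_closed empty_iff)
  have ob: "ord b = p"
    using ord_dvd_group_order[OF b(1)] b ord_eq_1[OF b(1)] p o by (metis prime_nat_iff)
  have "card (generate G {b}) = p" using generate_pow_card[OF b(1)] ob by simp
  then have "generate G {b} = carrier G"
    using o fin generate_incl[of "{b}"] b by (simp add: card_subset_eq order_def)
  then have gen: "\<exists>i::int. b [^] i = x" if "x \<in> carrier G" for x
  proof -
    have "x \<in> {b [^] k |k. k \<in> (UNIV :: int set)}"
      using generate_pow[OF b(1)] that \<open>generate G {b} = carrier G\<close> by simp
    then show ?thesis by blast
  qed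
  define \<mu> where "\<mu> x = (SOME i::int. b [^] i = x)" for x
  have \<mu>: "b [^] \<mu> x = x" if "x \<in> carrier G" for x
    unfolding \<mu>_def using gen[OF that] by (rule someI_ex)
  have eq: "[i = j] (mod int p) \<longleftrightarrow> b [^] i = b [^] j" for i j :: int
    using int_pow_eq[OF b(1), of j i] ob by (auto simp: cong_iff_dvd_diff)
  have "additive_mod p G \<mu>"
    unfolding additive_mod_def
  proof (intro ballI)
    fix x y assume "x \<in> carrier G" "y \<in> carrier G"
    then show "[\<mu> (x \<otimes> y) = \<mu> x + \<mu> y] (mod int p)"
      by (simp add: eq \<mu> int_pow_mult b)
  qed
  moreover have "[\<mu> x = 0] (mod int p) \<longleftrightarrow> x = \<one>" if "x \<in> carrier G" for x
    using \<mu>[OF that] by (simp add: eq)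
  ultimately show thesis using that by blast
qed

end

text \<open>
  The quotient by \<open>I\<close> is a nontrivial \<open>p\<close>-group, so it has a subgroup of index \<open>p\<close>.
\<close>

lemma (in comm_group) proper_subgroup_additive_mod:
  assumes p: "prime p" and o: "order G = p ^ k" and I: "subgroup I G" "I \<noteq> carrier G"
  obtains \<mu> x where "additive_mod p G \<mu>" "\<And>y. y \<in> I \<Longrightarrow> [\<mu> y = 0] (mod int p)"
    "x \<in> carrier G" "\<not> [\<mu> x = 0] (mod int p)"
proof -
  have fin: "finite (carrier G)" using o p prime_gt_0_nat by (metis order_gt_0_iff_finite zero_less_power)
  have nI: "I \<lhd> G" using I(1) by (rule subgroup_imp_normal)
  interpret I: normal I G by (rule nI)
  interpret Q: comm_group "G Mod I" using I(1) by (rule abelian_FactGroup)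
  have lag: "order (G Mod I) * card I = p ^ k"
    using lagrange[OF I(1)] o by (simp add: order_def FactGroup_def)
  then obtain j where j: "order (G Mod I) = p ^ j"
    using p by (metis divides_primepow_nat dvd_triv_left)
  have "j \<noteq> 0"
  proof
    assume "j = 0"
    then have "card I = card (carrier G)" using lag j o by (simp add: order_def)
    then show False using I subgroup.subset[OF I(1)] fin by (simp add: card_subset_eq)
  qed
  then obtain i where i: "j = Suc i" by (metis not0_implies_Suc)
  have finQ: "finite (carrier (G Mod I))" using fin by (simp add: carrier_FactGroup)
  obtain M where M: "subgroup M (G Mod I)" "card M = p ^ i"
    using sylow_thm[OF p Q.is_group _ finQ, of i p] j i by auto
  interpret M: normal M "G Mod I" using M(1) by (rule Q.subgroup_imp_normal)
  interpret B: group "G Mod I Mod M" by (rule M.factorgroup_is_group)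
  have "card (rcosets\<^bsub>G Mod I\<^esub> M) * p ^ i = p * p ^ i"
    using Q.lagrange[OF M(1)] unfolding M(2) j i by simp
  moreover have "order (G Mod I Mod M) = card (rcosets\<^bsub>G Mod I\<^esub> M)" by (simp add: order_def FactGroup_def)
  ultimately have oB: "order (G Mod I Mod M) = p" using p by (simp add: prime_gt_0_nat)
  define \<theta> where "\<theta> x = M #>\<^bsub>G Mod I\<^esub> (I #> x)" for x
  have "\<theta> = (\<lambda>X. M #>\<^bsub>G Mod I\<^esub> X) \<circ> (\<lambda>x. I #> x)" by (auto simp: \<theta>_def)
  then have \<theta>: "\<theta> \<in> hom G (G Mod I Mod M)"
    using Group.hom_compose[OF I.r_coset_hom_Mod M.r_coset_hom_Mod] by simp
  have surj: "\<theta> ` carrier G = carrier (G Mod I Mod M)"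
    by (auto simp: \<theta>_def carrier_FactGroup)
  obtain \<mu> where \<mu>: "additive_mod p (G Mod I Mod M) \<mu>"
      "\<And>X. X \<in> carrier (G Mod I Mod M) \<Longrightarrow> [\<mu> X = 0] (mod int p) \<longleftrightarrow> X = \<one>\<^bsub>G Mod I Mod M\<^esub>"
    using B.prime_order_additive_mod[OF p oB] by blast
  have "\<exists>X\<in>carrier (G Mod I Mod M). X \<noteq> \<one>\<^bsub>G Mod I Mod M\<^esub>"
  proof (rule ccontr)
    assume "\<not> ?thesis"
    then have "carrier (G Mod I Mod M) = {\<one>\<^bsub>G Mod I Mod M\<^esub>}" using B.one_closed by blast
    then have "order (G Mod I Mod M) = 1" by (simp add: order_def)
    then show False using oB p by simp
  qed
  then obtain x where x: "x \<in> carrier G" "\<theta> x \<noteq> \<one>\<^bsub>G Mod I Mod M\<^esub>" using surj by blast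
  have \<theta>c: "\<theta> y \<in> carrier (G Mod I Mod M)" if "y \<in> carrier G" for y using surj that by blast
  show thesis
  proof (rule that)
    show "additive_mod p G (\<lambda>x. \<mu> (\<theta> x))" using \<mu>(1) \<theta> by (rule additive_mod_comp)
    show "\<not> [\<mu> (\<theta> x) = 0] (mod int p)" using \<mu>(2)[OF \<theta>c] x by blast
    show "x \<in> carrier G" by fact
    fix y assume y: "y \<in> I"
    then have yc: "y \<in> carrier G" by simp
    have "I #> y = I" using y I.rcos_const is_group by blast
    then have "\<theta> y = M #>\<^bsub>G Mod I\<^esub> \<one>\<^bsub>G Mod I\<^esub>" by (simp add: \<theta>_def)
    also have "\<dots> = \<one>\<^bsub>G Mod I Mod M\<^esub>"
      using M.rcos_const[OF Q.is_group M.one_closed] by simp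
    finally show "[\<mu> (\<theta> y) = 0] (mod int p)" using \<mu>(2)[OF \<theta>c[OF yc]] by simp
  qed
qed

lemma (in comm_group) additive_mod_finprod:
  assumes "additive_mod p G \<mu>" "f \<in> A \<rightarrow> carrier G"
  shows "[\<mu> (finprod G f A) = (\<Sum>a\<in>A. \<mu> (f a))] (mod int p)"
  using assms(2)
proof (induction A rule: infinite_finite_induct)
  case (insert a A)
  then have "finprod G f (insert a A) = f a \<otimes> finprod G f A" by simp
  moreover have "[\<mu> (f a \<otimes> finprod G f A) = \<mu> (f a) + \<mu> (finprod G f A)] (mod int p)"
    using insert by (intro additive_modD[OF assms(1)]) auto
  moreover have "[\<mu> (f a) + \<mu> (finprod G f A) = \<mu> (f a) + (\<Sum>a\<in>A. \<mu> (f a))] (mod int p)"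
    using insert by (intro cong_add) auto
  ultimately show ?case using insert(1,2) by (metis cong_trans sum.insert)
qed (use additive_mod_one[OF assms(1)] in simp_all)

section \<open>The transfer into the normalizer of a Sylow subgroup\<close>

locale sylow_transfer = finite_group_prime +
  fixes P assumes P: "sylow_subgroup G p P"
begin

abbreviation "N \<equiv> normalizer G P"

lemmas PD = sylow_subgroupD[OF P]

lemma N: "subgroup N G" "N \<subseteq> carrier G"
  and N_eq: "N = {g \<in> carrier G. cnj G g ` P = P}"
  and P_N: "P \<subseteq> N"
proof -
  show 1: "subgroup N G" "N \<subseteq> carrier G" and 2: "N = {g \<in> carrier G. cnj G g ` P = P}"
    using normalizer_subgroup[OF PD(2)] normalizer_eq[OF PD(2)] by auto
  show "P \<subseteq> N"
    using PD(2) conj_self[OF PD(1)] unfolding 2 by blast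
qed

text \<open>
  A choice of \<open>t\<close> with \<open>Q = t P t\<^sup>-\<^sup>1\<close>; these form a transversal to the normalizer of \<open>P\<close>, with its left
  cosets labelled by the Sylow subgroups.
\<close>

definition conjugator :: "'a set \<Rightarrow> 'a" where
  "conjugator Q = (SOME t. t \<in> carrier G \<and> Q = cnj G t ` P)"

lemma conjugator: assumes "sylow_subgroup G p Q" shows "conjugator Q \<in> carrier G" "cnj G (conjugator Q) ` P = Q"
proof -
  have "\<exists>t. t \<in> carrier G \<and> Q = cnj G t ` P"
    using sylow_conjugate[OF P assms] by blast
  from someI_ex[OF this] show "conjugator Q \<in> carrier G" "cnj G (conjugator Q) ` P = Q"
    unfolding conjugator_def by auto
qed

text \<open>
  The factor of the transfer of \<open>g\<close> at the coset labelled by \<open>Q\<close>.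
\<close>

definition transfer_factor :: "'a \<Rightarrow> 'a set \<Rightarrow> 'a" where
  "transfer_factor g Q = inv (conjugator (cnj G g ` Q)) \<otimes> g \<otimes> conjugator Q"

lemma transfer_factor_in_N:
  assumes g: "g \<in> carrier G" and Q: "sylow_subgroup G p Q"
  shows "transfer_factor g Q \<in> N"
proof -
  let ?Q = "cnj G g ` Q"
  note r = conjugator[OF Q] and r' = conjugator[OF sylow_conj[OF Q g]]
  have c: "transfer_factor g Q \<in> carrier G" unfolding transfer_factor_def using g r r' by simp
  have "cnj G (transfer_factor g Q) ` P = cnj G (inv (conjugator ?Q)) ` cnj G g ` cnj G (conjugator Q) ` P"
    unfolding transfer_factor_def using g r(1) r'(1) PD(2) by (simp add: conj_mult conj_subset)
  also have "\<dots> = cnj G (inv (conjugator ?Q)) ` cnj G (conjugator ?Q) ` P" using r(2) r'(2) by simp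
  also have "\<dots> = P" using r'(1) PD(2) by simp
  finally show ?thesis using c by (simp add: N_eq)
qed

text \<open>
  The cocycle identity behind the multiplicativity of the transfer.
\<close>

lemma transfer_factor_mult:
  assumes g: "g \<in> carrier G" and h: "h \<in> carrier G" and Q: "sylow_subgroup G p Q"
  shows "transfer_factor (g \<otimes> h) Q = transfer_factor g (cnj G h ` Q) \<otimes> transfer_factor h Q"
proof -
  note r = conjugator(1)[OF Q] and r' = conjugator(1)[OF sylow_conj[OF Q h]]
  have "conjugator (cnj G g ` cnj G h ` Q) \<in> carrier G" using conjugator(1) sylow_conj Q g h by blast
  then show ?thesis
    unfolding transfer_factor_def conj_mult[OF g h sylow_subgroupD(2)[OF Q]]
    using g h r r' by (simp add: m_assoc)
qed

lemma conj_Syl: "g \<in> carrier G \<Longrightarrow> (`) (cnj G g) ` Syl = Syl" "g \<in> carrier G \<Longrightarrow> inj_on ((`) (cnj G g)) Syl"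
proof -
  assume g: "g \<in> carrier G"
  show inj: "inj_on ((`) (cnj G g)) Syl"
    by (rule inj_on_inverseI[where g = "(`) (cnj G (inv g))"]) (use g sylow_subgroupD(2) in auto)
  have "(`) (cnj G g) ` Syl \<subseteq> Syl" using g by (auto intro: sylow_conj)
  then show "(`) (cnj G g) ` Syl = Syl"
    using inj finite_Syl by (simp add: card_image card_subset_eq)
qed

lemma transfer_hom:
  assumes A: "comm_group A" and \<phi>: "\<phi> \<in> hom (G\<lparr>carrier := N\<rparr>) A"
  shows "(\<lambda>g. finprod A (\<lambda>Q. \<phi> (transfer_factor g Q)) Syl) \<in> hom G A"
proof -
  interpret A: comm_group A by (rule A)
  have \<phi>c: "\<phi> n \<in> carrier A" if "n \<in> N" for n using \<phi> that by (auto simp: hom_def)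
  have sc: "(\<lambda>Q. \<phi> (transfer_factor g Q)) \<in> Syl \<rightarrow> carrier A" if "g \<in> carrier G" for g
    using that by (auto intro!: \<phi>c transfer_factor_in_N)
  show ?thesis
  proof (rule homI)
    fix g assume "g \<in> carrier G"
    then show "finprod A (\<lambda>Q. \<phi> (transfer_factor g Q)) Syl \<in> carrier A" using sc by (simp add: A.finprod_closed)
  next
    fix g h assume g: "g \<in> carrier G" and h: "h \<in> carrier G"
    have sc': "(\<lambda>Q. \<phi> (transfer_factor g (cnj G h ` Q))) \<in> Syl \<rightarrow> carrier A"
      using g h by (auto intro!: \<phi>c transfer_factor_in_N sylow_conj)
    have "finprod A (\<lambda>Q. \<phi> (transfer_factor (g \<otimes> h) Q)) Syl
        = finprod A (\<lambda>Q. \<phi> (transfer_factor g (cnj G h ` Q)) \<otimes>\<^bsub>A\<^esub> \<phi> (transfer_factor h Q)) Syl"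
    proof (rule A.finprod_cong')
      fix Q assume "Q \<in> Syl"
      then have Q: "sylow_subgroup G p Q" by simp
      show "\<phi> (transfer_factor (g \<otimes> h) Q) = \<phi> (transfer_factor g (cnj G h ` Q)) \<otimes>\<^bsub>A\<^esub> \<phi> (transfer_factor h Q)"
        using \<phi> transfer_factor_in_N[OF g sylow_conj[OF Q h]] transfer_factor_in_N[OF h Q]
        by (simp add: transfer_factor_mult[OF g h Q] hom_def)
    qed (use sc[OF h] sc' in auto)
    also have "\<dots> = finprod A (\<lambda>Q. \<phi> (transfer_factor g (cnj G h ` Q))) Syl \<otimes>\<^bsub>A\<^esub> finprod A (\<lambda>Q. \<phi> (transfer_factor h Q)) Syl"
      using sc' sc[OF h] by (rule A.finprod_multf)
    also have "finprod A (\<lambda>Q. \<phi> (transfer_factor g (cnj G h ` Q))) Syl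
        = finprod A (\<lambda>Q. \<phi> (transfer_factor g Q)) ((`) (cnj G h) ` Syl)"
      using sc[OF g] conj_Syl[OF h] by (intro A.finprod_reindex[symmetric]) auto
    finally show "finprod A (\<lambda>Q. \<phi> (transfer_factor (g \<otimes> h) Q)) Syl
        = finprod A (\<lambda>Q. \<phi> (transfer_factor g Q)) Syl \<otimes>\<^bsub>A\<^esub> finprod A (\<lambda>Q. \<phi> (transfer_factor h Q)) Syl"
      by (simp add: conj_Syl[OF h])
  qed
qed

end

section \<open>Failure of control and characters with trivial transfer\<close>

lemma le_of_mult_eq:
  fixes a b x y :: nat
  assumes "a * x = b * y" "y \<le> x" "0 < a * x"
  shows "a \<le> b"
proof (rule ccontr)
  assume "\<not> a \<le> b"
  have "y \<noteq> 0" using assms(1,3) by (intro notI) simp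
  then have "b * y < a * y" using \<open>\<not> a \<le> b\<close> by simp
  also have "\<dots> \<le> a * x" using assms(2) by simp
  finally show False using assms(1) by simp
qed

context sylow_transfer
begin

abbreviation "GN \<equiv> G\<lparr>carrier := N\<rparr>"

text \<open>
  Surjectivity is a count of \<open>p\<close>-parts: as \<open>N\<close> contains a Sylow subgroup of \<open>G\<close>, its image in the \<open>p\<close>-group
  \<open>G/A\<^sup>p(G)\<close> has index prime to \<open>p\<close>.
\<close>

lemma FactGroup_Ap_hom:
  shows "(\<lambda>x. Ap p G #> x) \<in> hom GN (G Mod Ap p G)"
    "(\<lambda>x. Ap p G #> x) ` N = carrier (G Mod Ap p G)"
    "kernel GN (G Mod Ap p G) (\<lambda>x. Ap p G #> x) = N \<inter> Ap p G"
proof -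
  let ?A = "Ap p G" and ?h = "\<lambda>x. Ap p G #> x"
  interpret A: normal ?A G using Ap_least(1)[OF fin p] .
  interpret Q: comm_group "G Mod ?A" using Ap_least(2)[OF fin p] .
  interpret N: group GN using N(1) by (rule subgroup_imp_group)
  show hom: "?h \<in> hom GN (G Mod ?A)"
    using A.r_coset_hom_Mod N(2) by (auto simp: hom_def Pi_iff subset_iff)
  interpret h: group_hom GN "G Mod ?A" ?h
    using hom by (simp add: group_hom_def group_hom_axioms_def)
  have coset1: "?A #> x = ?A \<longleftrightarrow> x \<in> ?A" if "x \<in> carrier G" for x
    using that A.rcos_const is_group rcos_self[OF that A.is_subgroup] by auto
  show ker: "kernel GN (G Mod ?A) ?h = N \<inter> ?A"
    using coset1 N(2) by (auto simp: kernel_def)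
  let ?L = "N \<inter> ?A"
  have L: "?L \<lhd> GN" using h.normal_kernel ker by simp
  have img: "subgroup (?h ` N) (G Mod ?A)" using h.img_is_subgroup by simp
  have "(GN Mod ?L) \<cong> (G Mod ?A)\<lparr>carrier := ?h ` N\<rparr>"
  proof -
    have "group ((G Mod ?A)\<lparr>carrier := ?h ` N\<rparr>)" using img by (rule Q.subgroup_imp_group)
    then have "group_hom GN ((G Mod ?A)\<lparr>carrier := ?h ` N\<rparr>) ?h"
      using hom by (auto simp: group_hom_def group_hom_axioms_def hom_def)
    from group_hom.FactGroup_iso[OF this] show ?thesis using ker by (simp add: kernel_def)
  qed
  then have c1: "card (carrier (GN Mod ?L)) = card (?h ` N)" using iso_same_card by fastforce
  have cN: "card (?h ` N) * card ?L = card N"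
    using N.lagrange[OF normal_imp_subgroup[OF L]] c1 by (simp add: order_def FactGroup_def)
  have cG: "order (G Mod ?A) * card ?A = order G"
    using lagrange[OF A.is_subgroup] by (simp add: order_def FactGroup_def)
  obtain m where m: "order (G Mod ?A) = p ^ m"
    using Ap_least(3)[OF fin p] by (auto simp: p_group_def)
  have "card (?h ` N) dvd p ^ m"
    using Q.lagrange[OF img] m by (metis dvd_triv_right)
  then obtain a where a: "a \<le> m" "card (?h ` N) = p ^ a" using p by (metis divides_primepow_nat)
  let ?n = "multiplicity p (order G)"
  have "p ^ ?n dvd card N" using card_subgroup_dvd[OF fin N(1) PD(1) P_N] PD(4) by simp
  moreover have "card ?L dvd card ?A"
    by (rule card_subgroup_dvd[OF fin A.is_subgroup]) (use subgroups_Inter_pair N(1) A.is_subgroup in auto)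
  then have "p ^ a * card ?L dvd p ^ a * card ?A" by (rule mult_dvd_mono[OF dvd_refl])
  ultimately have "p ^ ?n dvd p ^ a * card ?A" using cN a(2) by (metis dvd_trans)
  \<comment> \<open>Multiplying by \<open>p\<^sup>m\<close> restores the full order of \<open>G\<close>, where the multiplicity of \<open>p\<close> is \<open>n\<close>.\<close>
  then have "p ^ ?n * p ^ m dvd p ^ a * card ?A * p ^ m" by (rule mult_dvd_mono[OF _ dvd_refl])
  also have "p ^ a * card ?A * p ^ m = p ^ a * order G" using cG m by (simp add: mult_ac)
  finally have dvd: "p ^ (?n + m) dvd p ^ a * order G" by (simp add: power_add)
  have "order G > 0" by (simp add: order_gt_0_iff_finite)
  then have "?n + m \<le> multiplicity p (p ^ a * order G)"
    using dvd p by (intro multiplicity_geI) (auto simp: prime_gt_0_nat)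
  also have "\<dots> = a + ?n"
    using \<open>order G > 0\<close> p by (simp add: prime_elem_multiplicity_mult_distrib)
  finally have "a = m" using a(1) by simp
  then have "card (?h ` N) = card (carrier (G Mod ?A))" using a m by (simp add: order_def)
  moreover have "?h ` N \<subseteq> carrier (G Mod ?A)" using subgroup.subset[OF img] .
  moreover have "finite (carrier (G Mod ?A))" by (simp add: carrier_FactGroup)
  ultimately show "?h ` N = carrier (G Mod ?A)" by (simp add: card_subset_eq)
qed

lemma index_coprime: "coprime (card (rcosets N)) p"
proof -
  have "\<not> p dvd card (rcosets N)"
  proof
    assume "p dvd card (rcosets N)"
    moreover have "p ^ multiplicity p (order G) dvd card N"
      using card_subgroup_dvd[OF fin N(1) PD(1) P_N] PD(4) by simp
    ultimately have "p ^ Suc (multiplicity p (order G)) dvd card (rcosets N) * card N"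
      by (simp add: mult_dvd_mono)
    also have "\<dots> = order G" using N(1) by (rule lagrange)
    finally show False
      using p order_gt_0_iff_finite fin multiplicity_lessI[of "order G" p] by (metis not_dvd_imp_multiplicity_0 power_dvd_iff_le_multiplicity Suc_n_not_le_n not_gr0 not_prime_unit)
  qed
  then show ?thesis using p by (metis coprime_commute prime_imp_coprime_nat)
qed

text \<open>
  The opposite inclusion always holds, since \<open>N/(N \<inter> A\<^sup>p(G))\<close> is isomorphic to the abelian \<open>p\<close>-group
  \<open>G/A\<^sup>p(G)\<close>.
\<close>

lemma controls_p_transferI:
  assumes "N \<inter> Ap p G \<subseteq> Ap p GN"
  shows "controls_p_transfer G p N"
proof -
  interpret N: group GN using N(1) by (rule subgroup_imp_group)
  have finN: "finite (carrier GN)" using finite_subset[OF N(2) fin] by simp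
  interpret Q: comm_group "G Mod Ap p G" using Ap_least(2)[OF fin p] .
  interpret h: group_hom GN "G Mod Ap p G" "\<lambda>x. Ap p G #> x"
    using FactGroup_Ap_hom(1) by (simp add: group_hom_def group_hom_axioms_def)
  have iso: "(GN Mod (N \<inter> Ap p G)) \<cong> (G Mod Ap p G)"
    using h.FactGroup_iso FactGroup_Ap_hom(2,3) by simp
  have nL: "N \<inter> Ap p G \<lhd> GN" using h.normal_kernel FactGroup_Ap_hom(3) by simp
  have gQ: "group (GN Mod (N \<inter> Ap p G))" using nL by (rule normal.factorgroup_is_group)
  have "comm_group (GN Mod (N \<inter> Ap p G))"
    using comm_group.iso_imp_comm_group[OF Q.comm_group_axioms _ group.is_monoid[OF gQ]]
      group.iso_sym[OF gQ iso] by blast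
  moreover have "p_group p (GN Mod (N \<inter> Ap p G))"
    using gQ iso_same_card[OF iso] Ap_least(3)[OF fin p] by (simp add: p_group_def order_def)
  ultimately have "Ap p GN \<subseteq> N \<inter> Ap p G"
    using N.Ap_least(4)[OF finN p nL] by blast
  then have "Ap p GN = N \<inter> Ap p G" using assms by blast
  then show ?thesis
    unfolding controls_p_transfer_def using N(1) index_coprime iso by simp
qed

text \<open>
  If the transfer \<open>V\<close> to \<open>N/A\<^sup>p(N)\<close> were onto, then \<open>N/A\<^sup>p(N)\<close> would be a quotient of \<open>G/A\<^sup>p(G)\<close>, which
  is isomorphic to \<open>N/(N \<inter> A\<^sup>p(G))\<close>; comparing orders would give \<open>A\<^sup>p(N) = N \<inter> A\<^sup>p(G)\<close> and hence control.
  So there is a nonzero character that vanishes on the image of \<open>V\<close>.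
\<close>

lemma character_with_trivial_transfer:
  assumes "\<not> controls_p_transfer G p N"
  obtains \<nu> n where "additive_mod p GN \<nu>" "n \<in> N" "\<not> [\<nu> n = 0] (mod int p)"
    "\<And>g. g \<in> carrier G \<Longrightarrow> [(\<Sum>Q\<in>Syl. \<nu> (transfer_factor g Q)) = 0] (mod int p)"
proof -
  interpret N: group GN using N(1) by (rule subgroup_imp_group)
  have finN: "finite (carrier GN)" "finite N" using finite_subset[OF N(2) fin] by simp_all
  let ?B = "Ap p GN" and ?L = "N \<inter> Ap p G"
  note B = N.Ap_least[OF finN(1) p]
  interpret B: normal ?B GN by (rule B(1))
  interpret A: comm_group "GN Mod ?B" by (rule B(2))
  define \<phi> where "\<phi> x = ?B #> x" for x
  have \<phi>: "\<phi> \<in> hom GN (GN Mod ?B)" using B.r_coset_hom_Mod unfolding \<phi>_def[abs_def] by simp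
  define V where "V g = finprod (GN Mod ?B) (\<lambda>Q. \<phi> (transfer_factor g Q)) Syl" for g
  have Vhom: "V \<in> hom G (GN Mod ?B)" unfolding V_def using B(2) \<phi> by (rule transfer_hom)
  interpret V: group_hom G "GN Mod ?B" V using Vhom by (simp add: group_hom_def group_hom_axioms_def)
  have img: "subgroup (V ` carrier G) (GN Mod ?B)" by (rule V.img_is_subgroup)
  obtain k where k: "order (GN Mod ?B) = p ^ k" using B(3) by (auto simp: p_group_def)
  have "V ` carrier G \<noteq> carrier (GN Mod ?B)"
  proof
    assume surj: "V ` carrier G = carrier (GN Mod ?B)"
    let ?K = "kernel G (GN Mod ?B) V"
    have nK: "?K \<lhd> G" by (rule V.normal_kernel)
    have iso: "(G Mod ?K) \<cong> (GN Mod ?B)" using surj by (rule V.FactGroup_iso)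
    have gQ: "group (G Mod ?K)" using nK by (rule normal.factorgroup_is_group)
    have "comm_group (G Mod ?K)"
      using comm_group.iso_imp_comm_group[OF B(2) _ group.is_monoid[OF gQ]] group.iso_sym[OF gQ iso] by blast
    moreover have "p_group p (G Mod ?K)"
      using gQ iso_same_card[OF iso] B(3) by (simp add: p_group_def order_def)
    ultimately have AK: "Ap p G \<subseteq> ?K" using Ap_least(4)[OF fin p nK] by blast
    have finK: "finite ?K" using fin by (simp add: kernel_def)
    interpret h: group_hom GN "G Mod Ap p G" "\<lambda>x. Ap p G #> x"
      using FactGroup_Ap_hom(1) Ap_least(2)[OF fin p]
      by (simp add: group_hom_def group_hom_axioms_def comm_group_def)
    have iso': "(GN Mod ?L) \<cong> (G Mod Ap p G)"
      using h.FactGroup_iso FactGroup_Ap_hom(2,3) by simp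
    have nL: "?L \<lhd> GN" using h.normal_kernel FactGroup_Ap_hom(3) by simp
    have l1: "order (GN Mod ?B) * card ?B = card N"
      using N.lagrange[OF B.is_subgroup] by (simp add: order_def FactGroup_def)
    have l2: "order (G Mod Ap p G) * card ?L = card N"
      using N.lagrange[OF normal_imp_subgroup[OF nL]] iso_same_card[OF iso'] by (simp add: order_def FactGroup_def)
    have l3: "order (GN Mod ?B) * card ?K = order G"
      using lagrange[OF normal_imp_subgroup[OF nK]] iso_same_card[OF iso] by (simp add: order_def FactGroup_def)
    have l4: "order (G Mod Ap p G) * card (Ap p G) = order G"
      using lagrange[OF normal_imp_subgroup[OF Ap_least(1)[OF fin p]]] by (simp add: order_def FactGroup_def)
    have pos: "order G > 0" "card N > 0"
      using order_gt_0_iff_finite finN N.one_closed by (auto simp: card_gt_0_iff)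
    have "card (Ap p G) \<le> card ?K" using AK finK by (rule card_mono[rotated])
    then have le: "order (GN Mod ?B) \<le> order (G Mod Ap p G)"
      using le_of_mult_eq[OF trans[OF l3 l4[symmetric]]] l3 pos(1) by simp
    have "card ?L \<le> card ?B"
    proof (rule le_of_mult_eq[OF _ le])
      show "card ?L * order (G Mod Ap p G) = card ?B * order (GN Mod ?B)"
        using l1 l2 by (simp only: mult.commute)
      show "0 < card ?L * order (G Mod Ap p G)" using l2 pos(2) by (simp only: mult.commute)
    qed
    have comm: "comm_group (GN Mod ?L)"
      using comm_group.iso_imp_comm_group[OF Ap_least(2)[OF fin p] group.iso_sym[OF _ iso']]
        normal.factorgroup_is_group[OF nL] group.is_monoid by blast
    have "p_group p (GN Mod ?L)"
      using comm iso_same_card[OF iso'] Ap_least(3)[OF fin p] by (simp add: p_group_def order_def comm_group_def)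
    then have "?B \<subseteq> ?L" using B(4)[OF nL comm] by blast
    moreover have "finite ?L" using finN by blast
    ultimately have "?B = ?L" using \<open>card ?L \<le> card ?B\<close> by (simp add: card_seteq)
    then show False using assms controls_p_transferI by blast
  qed
  then obtain \<mu> X where \<mu>: "additive_mod p (GN Mod ?B) \<mu>" "\<And>Y. Y \<in> V ` carrier G \<Longrightarrow> [\<mu> Y = 0] (mod int p)"
      "X \<in> carrier (GN Mod ?B)" "\<not> [\<mu> X = 0] (mod int p)"
    using A.proper_subgroup_additive_mod[OF p k img] by blast
  obtain n where n: "n \<in> N" "X = \<phi> n" using \<mu>(3) by (auto simp: carrier_FactGroup \<phi>_def)
  show thesis
  proof (rule that)
    show "additive_mod p GN (\<lambda>x. \<mu> (\<phi> x))" using \<mu>(1) \<phi> by (rule additive_mod_comp)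
    show "n \<in> N" "\<not> [\<mu> (\<phi> n) = 0] (mod int p)" using n \<mu>(4) by auto
    fix g assume g: "g \<in> carrier G"
    have "(\<lambda>Q. \<phi> (transfer_factor g Q)) \<in> Syl \<rightarrow> carrier (GN Mod ?B)"
      using \<phi> transfer_factor_in_N[OF g] by (auto simp: hom_def)
    then have "[\<mu> (V g) = (\<Sum>Q\<in>Syl. \<mu> (\<phi> (transfer_factor g Q)))] (mod int p)"
      unfolding V_def by (rule A.additive_mod_finprod[OF \<mu>(1)])
    moreover have "[\<mu> (V g) = 0] (mod int p)" using \<mu>(2) g by blast
    ultimately show "[(\<Sum>Q\<in>Syl. \<mu> (\<phi> (transfer_factor g Q))) = 0] (mod int p)"
      by (metis cong_sym cong_trans)
  qed
qed

end

section \<open>The transfer at an element of minimal order\<close>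

context finite_group_prime
begin

text \<open>
  The number \<open>r\<close> in the hypothesis is the length of the cycle of \<open>Q\<close> under conjugation by \<open>h\<close>. Unlike in
  \<open>cong_sum_fixed_points\<close>, the function need not be constant on the cycles.
\<close>

lemma cong_sum_cycles:
  fixes f :: "'a set \<Rightarrow> int"
  assumes h: "h \<in> carrier G" and X: "finite X" "\<And>Q. Q \<in> X \<Longrightarrow> Q \<subseteq> carrier G" "\<And>Q. Q \<in> X \<Longrightarrow> cnj G h ` Q \<in> X"
    and zero: "\<And>Q (r::nat). \<lbrakk>Q \<in> X; cnj G h ` Q \<noteq> Q; r > 0; \<And>n. cnj G (h [^] n) ` Q = Q \<longleftrightarrow> r dvd n\<rbrakk>
      \<Longrightarrow> [(\<Sum>i<r. f (cnj G (h [^] i) ` Q)) = 0] (mod m)"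
  shows "[sum f X = sum f {Q \<in> X. cnj G h ` Q = Q}] (mod m)"
proof -
  define c where "c Q i = cnj G (h [^] i) ` Q" for Q and i :: nat
  let ?cls = "\<lambda>Q. range (c Q)"
  have c0: "c Q 0 = Q" and cadd: "c (c Q i) j = c Q (i + j)" and c1: "c Q 1 = cnj G h ` Q" if "Q \<in> X" for Q i j
    using X(2)[OF that] h
    by (simp_all add: c_def conj_mult[symmetric] nat_pow_mult add.commute)
  have cX: "c Q i \<in> X" if "Q \<in> X" for Q i
  proof (induction i)
    case 0 then show ?case using c0[OF that] that by simp
  next
    case (Suc i)
    have "c Q (Suc i) = cnj G h ` c Q i" using cadd[OF that, of i 1] c1[OF Suc] by simp
    then show ?case using X(3)[OF Suc] by simp
  qed
  have ord: "c Q (order G * n) = Q" if "Q \<in> X" for Q n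
    using X(2)[OF that] h by (simp add: c_def nat_pow_pow[symmetric] pow_order_eq_1)
  have opos: "order G > 0" using fin by (simp add: order_gt_0_iff_finite)
  have fixed: "?cls Q = {Q} \<longleftrightarrow> cnj G h ` Q = Q" if Q: "Q \<in> X" for Q
  proof
    assume "?cls Q = {Q}"
    then show "cnj G h ` Q = Q" using c1[OF Q] by (metis rangeI singletonD)
  next
    assume "cnj G h ` Q = Q"
    then have "c Q i = Q" for i unfolding c_def using conj_pow_fixed[OF h X(2)[OF Q]] by simp
    then show "?cls Q = {Q}" by auto
  qed
  have "[sum f X = sum f {Q \<in> X. ?cls Q = {Q}}] (mod m)"
  proof (rule cong_sum_nontrivial_classes[OF X(1)])
    fix Q assume Q: "Q \<in> X"
    show "Q \<in> ?cls Q" using c0[OF Q] by (metis rangeI)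
    show "?cls Q \<subseteq> X" using cX[OF Q] by blast
    show "?cls R = ?cls Q" if R: "R \<in> ?cls Q" for R
    proof -
      obtain i where i: "R = c Q i" using R by auto
      have "c R j \<in> ?cls Q" for j using cadd[OF Q] i by simp
      moreover have "c Q j \<in> ?cls R" for j
      proof -
        \<comment> \<open>The remaining part of a full period, a multiple of the group order, leads back from \<open>R\<close> to \<open>Q\<close>.\<close>
        have "i \<le> order G * i" using opos by simp
        then have "i + (order G * i - i + j) = order G * i + j"
          by (simp only: add.assoc[symmetric] le_add_diff_inverse)
        then have "c R (order G * i - i + j) = c Q (order G * i + j)"
          by (simp only: i cadd[OF Q])
        also have "\<dots> = c (c Q (order G * i)) j" by (simp add: cadd[OF Q])
        also have "\<dots> = c Q j" by (simp add: ord[OF Q])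
        finally show ?thesis by (metis rangeI)
      qed
      ultimately show ?thesis by blast
    qed
    assume nt: "?cls Q \<noteq> {Q}"
    define r where "r = (LEAST r. r > 0 \<and> c Q r = Q)"
    have "order G > 0 \<and> c Q (order G) = Q" using opos ord[OF Q, of 1] by simp
    then have ex: "\<exists>r. r > 0 \<and> c Q r = Q" by (rule exI)
    have r: "r > 0" "c Q r = Q" using LeastI_ex[OF ex] by (simp_all add: r_def)
    have rmin: "r \<le> k" if "k > 0" "c Q k = Q" for k unfolding r_def using that by (intro Least_le) simp
    have mult: "c Q (r * k) = Q" for k
    proof (induction k)
      case (Suc k)
      then show ?case using cadd[OF Q, of "r * k" r] r(2) by (simp add: add.commute)
    qed (simp add: c0[OF Q])
    have mod: "c Q n = c Q (n mod r)" for n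
      using cadd[OF Q, of "r * (n div r)" "n mod r"] mult[of "n div r"] by simp
    have dvd: "c Q n = Q \<longleftrightarrow> r dvd n" for n
    proof
      assume "c Q n = Q"
      then have "c Q (n mod r) = Q" using mod by metis
      then have "n mod r = 0" using rmin[of "n mod r"] mod_less_divisor[OF r(1), of n] by linarith
      then show "r dvd n" by auto
    qed (use mult in auto)
    have cls: "?cls Q = c Q ` {..<r}"
      using mod r(1) by (auto simp: image_iff intro!: bexI[of _ "_ mod r"])
    have "inj_on (c Q) {..<r}"
    proof (rule linorder_inj_onI)
      fix i j assume ij: "i < j" "i \<in> {..<r}" "j \<in> {..<r}"
      show "c Q i \<noteq> c Q j"
      proof
        assume "c Q i = c Q j"
        then have "c Q (i + (r - i)) = c Q (j + (r - i))"
          by (simp only: cadd[OF Q, symmetric])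
        then have "c Q (j + (r - i)) = Q" using ij r(2) by simp
        then have "r dvd j + (r - i)" using dvd by blast
        moreover have "j + (r - i) = r + (j - i)" using ij by simp
        ultimately have "r dvd j - i" by simp
        then show False using ij by (auto dest: dvd_imp_le)
      qed
    qed auto
    then have "sum f (?cls Q) = (\<Sum>i<r. f (c Q i))" unfolding cls by (simp add: sum.reindex)
    moreover have "[(\<Sum>i<r. f (c Q i)) = 0] (mod m)"
    proof -
      have "cnj G h ` Q \<noteq> Q" using nt fixed[OF Q] by simp
      from zero[OF Q this r(1) dvd[unfolded c_def]] show ?thesis by (simp only: c_def)
    qed
    ultimately show "[sum f (?cls Q) = 0] (mod m)" by simp
  qed
  moreover have "{Q \<in> X. ?cls Q = {Q}} = {Q \<in> X. cnj G h ` Q = Q}" by (rule Collect_cong, rule conj_cong[OF refl], rule fixed)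
  ultimately show ?thesis by simp
qed

end

locale sylow_character = sylow_transfer +
  fixes \<nu> :: "'a \<Rightarrow> int"
  assumes add: "additive_mod p GN \<nu>"
begin

lemma nu_mult: "\<lbrakk>x \<in> N; y \<in> N\<rbrakk> \<Longrightarrow> [\<nu> (x \<otimes> y) = \<nu> x + \<nu> y] (mod int p)"
  using additive_modD[OF add] by simp

lemma nu_one: "[\<nu> \<one> = 0] (mod int p)"
  using group.additive_mod_one[OF subgroup_imp_group[OF N(1)] add] by simp

lemma nu_conj:
  assumes n: "n \<in> N" and u: "u \<in> N"
  shows "[\<nu> (cnj G n u) = \<nu> u] (mod int p)"
proof -
  have i: "inv n \<in> N" using n N(1) by (simp add: subgroup.m_inv_closed)
  have nu: "n \<otimes> u \<in> N" using n u N(1) by (simp add: subgroup.m_closed)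
  have c: "n \<in> carrier G" using n N(2) by blast
  have 1: "[\<nu> n + \<nu> (inv n) = 0] (mod int p)"
    using cong_trans[OF cong_sym[OF nu_mult[OF n i]]] nu_one c by simp
  have "[\<nu> (n \<otimes> u \<otimes> inv n) = \<nu> (n \<otimes> u) + \<nu> (inv n)] (mod int p)" using nu i by (rule nu_mult)
  also have "[\<nu> (n \<otimes> u) + \<nu> (inv n) = \<nu> n + \<nu> u + \<nu> (inv n)] (mod int p)"
    using nu_mult[OF n u] by (rule cong_add) simp
  also have "\<nu> n + \<nu> u + \<nu> (inv n) = \<nu> u + (\<nu> n + \<nu> (inv n))" by simp
  also have "[\<nu> u + (\<nu> n + \<nu> (inv n)) = \<nu> u + 0] (mod int p)" using 1 by (rule cong_add[OF cong_refl])
  finally show ?thesis by (simp add: cnj_def)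
qed

text \<open>
  The character \<open>\<nu>\<close> transported from \<open>P\<close> to the Sylow subgroup \<open>Q\<close>. By \<open>nu_at_eq\<close>, its value at an element of
  \<open>Q\<close> depends modulo \<open>p\<close> only on \<open>Q\<close>, and not on the chosen conjugator.
\<close>

definition nu_at :: "'a set \<Rightarrow> 'a \<Rightarrow> int" where
  "nu_at Q u = \<nu> (cnj G (inv (conjugator Q)) u)"

lemma pull_back_in_P:
  assumes "t \<in> carrier G" "u \<in> cnj G t ` P"
  shows "cnj G (inv t) u \<in> P"
proof -
  have "u \<in> carrier G" using assms PD(2) by auto
  then show ?thesis using assms mem_conj_iff[OF assms(1) PD(2)] by blast
qed

lemma nu_at_eq:
  assumes t: "t \<in> carrier G" and Q: "Q = cnj G t ` P" and u: "u \<in> Q"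
  shows "[nu_at Q u = \<nu> (cnj G (inv t) u)] (mod int p)"
proof -
  have Qs: "sylow_subgroup G p Q" unfolding Q using P t by (rule sylow_conj)
  note r = conjugator[OF Qs]
  have uc: "u \<in> carrier G" using u sylow_subgroupD(2)[OF Qs] by blast
  define n where "n = inv (conjugator Q) \<otimes> t"
  have nc: "n \<in> carrier G" using r t by (simp add: n_def)
  have "cnj G n ` P = cnj G (inv (conjugator Q)) ` cnj G t ` P" unfolding n_def using r t PD(2) by (intro conj_mult) auto
  also have "\<dots> = cnj G (inv (conjugator Q)) ` cnj G (conjugator Q) ` P" by (simp only: Q[symmetric] r(2))
  also have "\<dots> = P" by (rule conj_inv_cancel(1)[OF r(1) PD(2)])
  finally have "n \<in> N" using nc by (simp add: N_eq)
  moreover have "cnj G (inv t) u \<in> N" using pull_back_in_P[OF t] u Q P_N by blast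
  ultimately have "[\<nu> (cnj G n (cnj G (inv t) u)) = \<nu> (cnj G (inv t) u)] (mod int p)" by (rule nu_conj)
  moreover have "cnj G n (cnj G (inv t) u) = cnj G (inv (conjugator Q)) u"
    using r t uc by (simp add: n_def cnj_cnj[symmetric] m_assoc)
  ultimately show ?thesis by (simp add: nu_at_def)
qed

lemma nu_at_mult:
  assumes Q: "sylow_subgroup G p Q" and u: "u \<in> Q" "v \<in> Q"
  shows "[nu_at Q (u \<otimes> v) = nu_at Q u + nu_at Q v] (mod int p)"
proof -
  note r = conjugator[OF Q]
  have "cnj G (inv (conjugator Q)) u \<in> N" "cnj G (inv (conjugator Q)) v \<in> N"
    using pull_back_in_P[OF r(1)] r(2) u P_N by auto
  moreover have "u \<in> carrier G" "v \<in> carrier G" using u sylow_subgroupD(2)[OF Q] by auto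
  ultimately show ?thesis unfolding nu_at_def using nu_mult r(1) by (simp add: cnj_mult)
qed

lemma nu_at_pow:
  assumes Q: "sylow_subgroup G p Q" and u: "u \<in> Q"
  shows "[nu_at Q (u [^] (k::nat)) = int k * nu_at Q u] (mod int p)"
proof -
  interpret Q: group "G\<lparr>carrier := Q\<rparr>" using sylow_subgroupD(1)[OF Q] by (rule subgroup_imp_group)
  have "additive_mod p (G\<lparr>carrier := Q\<rparr>) (nu_at Q)"
    unfolding additive_mod_def using nu_at_mult[OF Q] by simp
  from Q.additive_mod_pow[OF this] show ?thesis using u by (simp add: nat_pow_consistent[symmetric])
qed

lemma nu_at_conj:
  assumes Q: "sylow_subgroup G p Q" and u: "u \<in> Q" and g: "g \<in> carrier G"
  shows "[nu_at (cnj G g ` Q) (cnj G g u) = nu_at Q u] (mod int p)"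
proof -
  note r = conjugator[OF Q]
  have uc: "u \<in> carrier G" using u sylow_subgroupD(2)[OF Q] by blast
  have "cnj G g ` Q = cnj G (g \<otimes> conjugator Q) ` P" using r g PD(2) by (simp add: conj_mult)
  then have "[nu_at (cnj G g ` Q) (cnj G g u) = \<nu> (cnj G (inv (g \<otimes> conjugator Q)) (cnj G g u))] (mod int p)"
    using g r u by (intro nu_at_eq) auto
  moreover have "cnj G (inv (g \<otimes> conjugator Q)) (cnj G g u) = cnj G (inv (conjugator Q)) u"
    using g r uc by (simp add: inv_mult_group cnj_cnj)
  ultimately show ?thesis by (simp add: nu_at_def)
qed

lemma nu_at_centralizer:
  assumes c: "c \<in> carrier G" "Q = cnj G c ` P" "cnj G c u = u" and u: "u \<in> Q" "u \<in> P"
  shows "[nu_at Q u = \<nu> u] (mod int p)"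
proof -
  have "u \<in> carrier G" using u PD(2) by blast
  then have "cnj G (inv c) u = u" using c cnj_cancel(2)[of c u] by simp
  then show ?thesis using nu_at_eq[OF c(1,2) u(1)] by simp
qed

text \<open>
  Every element of \<open>N\<close> has a power in \<open>P\<close> whose exponent, the index of \<open>P\<close> in \<open>N\<close>, is prime to \<open>p\<close>.
\<close>

lemma nonzero_on_sylow:
  assumes n: "n \<in> N" "\<not> [\<nu> n = 0] (mod int p)"
  shows "\<exists>y\<in>P. \<not> [\<nu> y = 0] (mod int p)"
proof (rule ccontr)
  assume "\<not> ?thesis"
  then have zero: "[\<nu> y = 0] (mod int p)" if "y \<in> P" for y using that by blast
  interpret N: group GN using N(1) by (rule subgroup_imp_group)
  have "P \<lhd> GN"
  proof (rule N.normal_invI)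
    show "subgroup P GN" using PD(1) N(1) P_N by (rule subgroup_incl)
    fix x h assume x: "x \<in> carrier GN" and h: "h \<in> P"
    then have "cnj G x h \<in> P" unfolding N_eq by auto
    then show "x \<otimes>\<^bsub>GN\<^esub> h \<otimes>\<^bsub>GN\<^esub> inv\<^bsub>GN\<^esub> x \<in> P"
      using x N(1) by (simp add: cnj_def m_inv_consistent)
  qed
  then interpret P: normal P GN .
  interpret Q: group "GN Mod P" by (rule P.factorgroup_is_group)
  define k where "k = order (GN Mod P)"
  have kP: "k * card P = card N"
    using N.lagrange[OF P.is_subgroup] by (simp add: k_def order_def FactGroup_def)
  have ncarr: "n \<in> carrier GN" using n by simp
  have "n [^] k \<in> P"
  proof -
    have "P #>\<^bsub>GN\<^esub> n \<in> carrier (GN Mod P)" using ncarr unfolding carrier_FactGroup by (rule imageI)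
    then have "(P #>\<^bsub>GN\<^esub> n) [^]\<^bsub>GN Mod P\<^esub> k = \<one>\<^bsub>GN Mod P\<^esub>" unfolding k_def by (rule Q.pow_order_eq_1)
    then have "P #>\<^bsub>GN\<^esub> (n [^]\<^bsub>GN\<^esub> k) = P" using P.FactGroup_pow[OF ncarr] by simp
    then have "n [^]\<^bsub>GN\<^esub> k \<in> P" using N.coset_join1[OF _ _ P.is_subgroup] N.nat_pow_closed[OF ncarr] by blast
    then show ?thesis by (simp add: nat_pow_consistent[symmetric])
  qed
  then have "[\<nu> (n [^] k) = 0] (mod int p)" by (rule zero)
  moreover have "[\<nu> (n [^] k) = int k * \<nu> n] (mod int p)"
    using N.additive_mod_pow[OF add ncarr, of k] by (simp add: nat_pow_consistent[symmetric])
  ultimately have "int p dvd int k * \<nu> n" by (metis cong_0_iff cong_sym cong_trans)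
  moreover have "\<not> int p dvd \<nu> n" using n(2) by (simp add: cong_0_iff)
  ultimately have "p dvd k" using p by (simp add: prime_dvd_mult_iff)
  have "card N dvd order G"
    using lagrange[OF N(1)] by (metis dvd_triv_right)
  then have "k * card P dvd order G" using kP by simp
  then have "p * p ^ multiplicity p (order G) dvd order G"
    using \<open>p dvd k\<close> PD(4) by (metis dvd_refl dvd_trans mult_dvd_mono)
  then have "p dvd order G div p ^ multiplicity p (order G)"
    using p by (metis dvd_mult_imp_div)
  moreover have "order G > 0" using fin by (simp add: order_gt_0_iff_finite)
  ultimately show False using not_dvd_div_multiplicity by blast
qed

text \<open>
  The contributions along the orbit of \<open>Q\<close> under the powers of \<open>h\<close> telescope.
\<close>

lemma sum_transfer_factor_powers:
  assumes h: "h \<in> carrier G" and Q: "sylow_subgroup G p Q"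
  shows "[(\<Sum>i<r. \<nu> (transfer_factor h (cnj G (h [^] i) ` Q))) = \<nu> (transfer_factor (h [^] (r::nat)) Q)] (mod int p)"
proof (induction r)
  case 0
  have "transfer_factor \<one> Q = \<one>" using conjugator[OF Q] sylow_subgroupD(2)[OF Q] by (simp add: transfer_factor_def)
  then show ?case using cong_sym[OF nu_one] by simp
next
  case (Suc r)
  have hr: "h [^] r \<in> carrier G" using h by simp
  have Qr: "sylow_subgroup G p (cnj G (h [^] r) ` Q)" using Q hr by (rule sylow_conj)
  have "transfer_factor (h [^] Suc r) Q = transfer_factor (h \<otimes> h [^] r) Q" by (simp only: nat_pow_Suc2[OF h])
  also have "\<dots> = transfer_factor h (cnj G (h [^] r) ` Q) \<otimes> transfer_factor (h [^] r) Q" using h hr Q by (rule transfer_factor_mult)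
  finally have "[\<nu> (transfer_factor (h [^] Suc r) Q) = \<nu> (transfer_factor h (cnj G (h [^] r) ` Q)) + \<nu> (transfer_factor (h [^] r) Q)] (mod int p)"
    using nu_mult[OF transfer_factor_in_N[OF h Qr] transfer_factor_in_N[OF hr Q]] by simp
  moreover have "[(\<Sum>i<Suc r. \<nu> (transfer_factor h (cnj G (h [^] i) ` Q)))
      = \<nu> (transfer_factor h (cnj G (h [^] r) ` Q)) + \<nu> (transfer_factor (h [^] r) Q)] (mod int p)"
    using cong_add[OF Suc cong_refl[of "\<nu> (transfer_factor h (cnj G (h [^] r) ` Q))"]] by (simp add: add.commute)
  ultimately show ?case by (rule cong_trans[OF _ cong_sym, rotated])
qed

lemma transfer_factor_fixed:
  assumes "sylow_subgroup G p Q" "h \<in> carrier G" "cnj G h ` Q = Q"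
  shows "transfer_factor h Q = cnj G (inv (conjugator Q)) h"
  using assms conjugator(1)[OF assms(1)] by (simp add: transfer_factor_def cnj_def)

text \<open>
  A Sylow subgroup \<open>Q\<close> that is moved by \<open>y\<close> lies in a cycle of length \<open>r > 1\<close>, a power of \<open>p\<close>. That cycle
  contributes the value of \<open>\<nu>\<close> at a conjugate of \<open>y\<^sup>r\<close> in \<open>P\<close>, and \<open>y\<^sup>r\<close> has smaller order than \<open>y\<close>.
\<close>

lemma transfer_at_minimal:
  assumes y: "y \<in> P" and min: "\<And>u. \<lbrakk>u \<in> P; ord u < ord y\<rbrakk> \<Longrightarrow> [\<nu> u = 0] (mod int p)"
    and V: "[(\<Sum>Q\<in>Syl. \<nu> (transfer_factor y Q)) = 0] (mod int p)"
  shows "[(\<Sum>Q\<in>{Q\<in>Syl. y \<in> Q}. nu_at Q y) = 0] (mod int p)"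
proof -
  have yc: "y \<in> carrier G" using y PD(2) by blast
  obtain k where k: "ord y = p ^ k" using ord_in_sylow[OF P y] .
  have "[(\<Sum>Q\<in>Syl. \<nu> (transfer_factor y Q)) = (\<Sum>Q\<in>{Q\<in>Syl. cnj G y ` Q = Q}. \<nu> (transfer_factor y Q))] (mod int p)"
  proof (rule cong_sum_cycles[OF yc finite_Syl])
    fix Q and r :: nat assume "Q \<in> Syl" and ne: "cnj G y ` Q \<noteq> Q" and r: "r > 0"
      and per: "\<And>n. cnj G (y [^] n) ` Q = Q \<longleftrightarrow> r dvd n"
    then have Q: "sylow_subgroup G p Q" by simp
    have "cnj G (y [^] ord y) ` Q = Q" using yc sylow_subgroupD(2)[OF Q] by simp
    then have "r dvd ord y" using per by blast
    have "r \<noteq> 1" using per[of 1] ne yc by auto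
    have opos: "ord y > 0" using k p by (simp add: prime_gt_0_nat)
    have oyr: "ord (y [^] r) = ord y div r" using ord_pow[OF yc \<open>r dvd ord y\<close>] r by simp
    then have lt: "ord (y [^] r) < ord y" using opos r \<open>r \<noteq> 1\<close> by simp
    obtain j where j: "ord (y [^] r) = p ^ j"
      using oyr \<open>r dvd ord y\<close> k p by (metis div_dvd_iff_mult divides_primepow_nat dvd_div_mult_self dvd_triv_left)
    have fx: "cnj G (y [^] r) ` Q = Q" using per[of r] by simp
    have "y [^] r \<in> Q" using p_element_normalizing_sylow[OF Q _ j fx] yc by simp
    then have "cnj G (inv (conjugator Q)) (y [^] r) \<in> P"
      using pull_back_in_P[OF conjugator(1)[OF Q]] conjugator(2)[OF Q] by simp
    moreover have "ord (cnj G (inv (conjugator Q)) (y [^] r)) < ord y"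
    proof -
      let ?c = "cnj G (inv (conjugator Q))"
      have rc: "inv (conjugator Q) \<in> carrier G" using conjugator(1)[OF Q] by simp
      have "ord (?c (y [^] r)) dvd ord (y [^] r)"
        using rc yc by (simp add: pow_eq_id[symmetric] cnj_pow[symmetric]) (simp add: cnj_def)
      then show ?thesis using lt opos j p by (metis dvd_imp_le le_less_trans prime_gt_0_nat zero_less_power)
    qed
    ultimately have "[\<nu> (cnj G (inv (conjugator Q)) (y [^] r)) = 0] (mod int p)" by (rule min)
    then have "[\<nu> (transfer_factor (y [^] r) Q) = 0] (mod int p)" using transfer_factor_fixed[OF Q _ fx] yc by simp
    with sum_transfer_factor_powers[OF yc Q, of r]
    show "[(\<Sum>i<r. \<nu> (transfer_factor y (cnj G (y [^] i) ` Q))) = 0] (mod int p)" by (rule cong_trans)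
  qed (use yc in \<open>auto simp: sylow_conj dest: sylow_subgroupD(2)\<close>)
  moreover have "{Q\<in>Syl. cnj G y ` Q = Q} = {Q\<in>Syl. y \<in> Q}"
  proof (rule Collect_cong, rule conj_cong[OF refl])
    fix Q assume "Q \<in> Syl"
    then have Q: "sylow_subgroup G p Q" by simp
    show "cnj G y ` Q = Q \<longleftrightarrow> y \<in> Q"
      using p_element_normalizing_sylow[OF Q yc k] conj_self[OF sylow_subgroupD(1)[OF Q]] by auto
  qed
  moreover have "(\<Sum>Q\<in>{Q\<in>Syl. y \<in> Q}. \<nu> (transfer_factor y Q)) = (\<Sum>Q\<in>{Q\<in>Syl. y \<in> Q}. nu_at Q y)"
  proof (rule sum.cong)
    fix Q assume "Q \<in> {Q\<in>Syl. y \<in> Q}"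
    then have Q: "sylow_subgroup G p Q" "y \<in> Q" by auto
    then show "\<nu> (transfer_factor y Q) = nu_at Q y"
      using transfer_factor_fixed[OF Q(1) yc] conj_self[OF sylow_subgroupD(1)[OF Q(1)] Q(2)] by (simp add: nu_at_def)
  qed simp
  ultimately show ?thesis using V by (metis (no_types, lifting) cong_sym cong_trans)
qed

end

section \<open>The norm of a Sylow subgroup\<close>

lemma cong_prime_power_exponent:
  fixes i p :: nat
  assumes p: "prime p"
  shows "[i ^ (p ^ k) = i] (mod p)"
proof (induction k)
  case (Suc k)
  have fermat: "[a ^ p = a] (mod p)" for a :: nat
  proof (cases "p dvd a")
    case True
    then show ?thesis using p by (metis cong_0_iff cong_sym cong_trans dvd_power prime_gt_0_nat dvd_trans)
  next
    case False
    have "[a * a ^ (p - 1) = a * 1] (mod p)" using fermat_theorem[OF p False] by (rule cong_scalar_left)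
    moreover have "a * a ^ (p - 1) = a ^ p" using p by (metis power_minus_mult prime_gt_0_nat mult.commute)
    ultimately show ?thesis by simp
  qed
  have "i ^ (p ^ Suc k) = (i ^ (p ^ k)) ^ p" by (simp add: power_mult[symmetric] mult.commute)
  then show ?case using cong_trans[OF fermat[of "i ^ (p ^ k)"] Suc] by simp
qed simp

context sylow_transfer
begin

abbreviation "Z \<equiv> group_norm (G\<lparr>carrier := P\<rparr>)"

lemma Z_iff: "z \<in> Z \<longleftrightarrow> z \<in> P \<and> (\<forall>H. subgroup H G \<longrightarrow> H \<subseteq> P \<longrightarrow> cnj G z ` H = H)"
proof -
  have sub: "subgroup H (G\<lparr>carrier := P\<rparr>) \<longleftrightarrow> subgroup H G \<and> H \<subseteq> P" for H
    using incl_subgroup[OF PD(1)] subgroup_incl[OF _ PD(1)] subgroup.subset[of H "G\<lparr>carrier := P\<rparr>"] by auto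
  have norm: "normalizer (G\<lparr>carrier := P\<rparr>) H = {g \<in> P. cnj G g ` H = H}" if "H \<subseteq> P" for H
    using normalizer_consistent[OF PD(1) that] normalizer_eq[of H] that PD(2) by auto
  have "z \<in> Z \<longleftrightarrow> (\<forall>H. subgroup H G \<and> H \<subseteq> P \<longrightarrow> z \<in> normalizer (G\<lparr>carrier := P\<rparr>) H)"
    by (simp add: group_norm_def sub)
  also have "\<dots> \<longleftrightarrow> (\<forall>H. subgroup H G \<and> H \<subseteq> P \<longrightarrow> z \<in> P \<and> cnj G z ` H = H)"
    using norm by simp
  also have "\<dots> \<longleftrightarrow> z \<in> P \<and> (\<forall>H. subgroup H G \<longrightarrow> H \<subseteq> P \<longrightarrow> cnj G z ` H = H)"
    using PD(1) by auto
  finally show ?thesis .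
qed

lemma Z_P: "Z \<subseteq> P" and Z_carrier: "Z \<subseteq> carrier G"
  using Z_iff PD(2) by auto

lemma Z_normalizes: "\<lbrakk>z \<in> Z; subgroup H G; H \<subseteq> P\<rbrakk> \<Longrightarrow> cnj G z ` H = H"
  using Z_iff by simp

lemma Z_subgroup: "subgroup Z G"
proof (rule subgroupI)
  show "Z \<subseteq> carrier G" by (rule Z_carrier)
  have "\<one> \<in> Z" unfolding Z_iff using subgroup.one_closed[OF PD(1)] conj_one[OF subgroup.subset] by blast
  then show "Z \<noteq> {}" by blast
  fix a assume a: "a \<in> Z"
  show "inv a \<in> Z" unfolding Z_iff
  proof (intro conjI allI impI)
    show "inv a \<in> P" using a Z_P PD(1) by (auto simp: subgroup.m_inv_closed)
    fix H assume H: "subgroup H G" "H \<subseteq> P"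
    have "cnj G (inv a) ` cnj G a ` H = H" using a Z_carrier subgroup.subset[OF H(1)] by (intro conj_inv_cancel) auto
    then show "cnj G (inv a) ` H = H" using Z_normalizes[OF a H] by simp
  qed
  fix b assume b: "b \<in> Z"
  show "a \<otimes> b \<in> Z" unfolding Z_iff
  proof (intro conjI allI impI)
    show "a \<otimes> b \<in> P" using subgroup.m_closed[OF PD(1)] a b Z_P by blast
    fix H assume H: "subgroup H G" "H \<subseteq> P"
    have "cnj G (a \<otimes> b) ` H = cnj G a ` cnj G b ` H" using a b Z_carrier subgroup.subset[OF H(1)] by (intro conj_mult) auto
    then show "cnj G (a \<otimes> b) ` H = H" using Z_normalizes[OF a H] Z_normalizes[OF b H] by simp
  qed
qed

text \<open>
  The norm is normal in \<open>P\<close>, because conjugation by \<open>g\<close> permutes the subgroups of \<open>P\<close>.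
\<close>

lemma conj_Z: assumes g: "g \<in> P" shows "cnj G g ` Z = Z"
proof -
  have gc: "g \<in> carrier G" using g PD(2) by blast
  have "cnj G g ` Z \<subseteq> Z"
  proof
    fix x assume "x \<in> cnj G g ` Z"
    then obtain z where z: "z \<in> Z" "x = cnj G g z" by blast
    have zc: "z \<in> carrier G" using z Z_carrier by blast
    show "x \<in> Z" unfolding Z_iff
    proof (intro conjI allI impI)
      show "x \<in> P" using z g Z_P PD(1) by (auto simp: cnj_def subgroup.m_closed subgroup.m_inv_closed)
      fix H assume H: "subgroup H G" "H \<subseteq> P"
      have Hc: "H \<subseteq> carrier G" using H(1) by (rule subgroup.subset)
      let ?H = "cnj G (inv g) ` H"
      have "cnj G (inv g) ` P = P" using g PD(1) by (intro conj_self) (auto simp: subgroup.m_inv_closed)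
      then have H': "subgroup ?H G" "?H \<subseteq> P" using gc H by (auto simp: conj_subgroup)
      have "cnj G x ` H = cnj G g ` cnj G z ` ?H"
        unfolding z(2) cnj_def[of G g z] using gc zc Hc conj_mult[of "g \<otimes> z" "inv g" H] conj_mult[of g z ?H]
        by (simp add: conj_subset)
      also have "\<dots> = cnj G g ` ?H" using Z_normalizes[OF z(1) H'] by simp
      also have "\<dots> = H" using gc Hc by (rule conj_inv_cancel)
      finally show "cnj G x ` H = H" .
    qed
  qed
  moreover have "finite Z" using Z_P PD(3) by (rule finite_subset)
  ultimately show ?thesis using card_conj[OF gc Z_carrier] by (simp add: card_subset_eq)
qed

lemma cnj_Z_power:
  assumes "z \<in> Z" "y \<in> P" shows "\<exists>k::nat. cnj G z y = y [^] k"
proof -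
  have yc: "y \<in> carrier G" using assms PD(2) by blast
  have "generate G {y} \<subseteq> P" using generate_subgroup_incl[OF _ PD(1)] assms(2) by simp
  then have "cnj G z ` generate G {y} = generate G {y}"
    using Z_normalizes[OF assms(1) generate_is_subgroup] yc by simp
  then have "cnj G z y \<in> generate G {y}" using generate.incl[of y "{y}" G] by blast
  then show ?thesis using generate_powers[OF yc] by auto
qed

lemma pow_in_Z_iff:
  assumes g: "g \<in> carrier G" "g \<notin> Z" "g [^] p \<in> Z"
  shows "g [^] (n::nat) \<in> Z \<longleftrightarrow> p dvd n"
proof
  assume "p dvd n"
  then obtain k where "n = p * k" by blast
  then have "g [^] n = (g [^] p) [^] k" using g(1) by (simp add: nat_pow_pow)
  then show "g [^] n \<in> Z" using subgroup_nat_pow_closed[OF Z_subgroup g(3)] by simp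
next
  assume n: "g [^] n \<in> Z"
  show "p dvd n"
  proof (rule ccontr)
    assume "\<not> p dvd n"
    then have "coprime n p" using p by (metis coprime_commute prime_imp_coprime_nat)
    then obtain a b where ab: "n * a = p * b + 1"
      using coprime_bezout_strong[of n p] p by (metis not_prime_1)
    have "(g [^] n) [^] a = (g [^] p) [^] b \<otimes> g"
      using g(1) ab by (simp add: nat_pow_pow)
    moreover have "(g [^] n) [^] a \<in> Z" "(g [^] p) [^] b \<in> Z"
      using subgroup_nat_pow_closed[OF Z_subgroup] n g(3) by auto
    ultimately have "g = inv ((g [^] p) [^] b) \<otimes> (g [^] n) [^] a" using g(1) by simp
    also have "\<dots> \<in> Z" using \<open>(g [^] n) [^] a \<in> Z\<close> \<open>(g [^] p) [^] b \<in> Z\<close> Z_subgroup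
      by (simp add: subgroup.m_closed subgroup.m_inv_closed)
    finally show False using g(2) by blast
  qed
qed

lemma exists_order_p_mod_Z:
  assumes "Z \<noteq> P"
  obtains g where "g \<in> P" "g \<notin> Z" "g [^] p \<in> Z"
proof -
  obtain g0 where g0: "g0 \<in> P" "g0 \<notin> Z" using assms Z_P by blast
  have c: "g0 \<in> carrier G" using g0 PD(2) by blast
  obtain k where k: "ord g0 = p ^ k" using ord_in_sylow[OF P g0(1)] .
  have "g0 [^] (p ^ k) \<in> Z" using c k subgroup.one_closed[OF Z_subgroup] pow_ord_eq_1[OF c] by simp
  then have ex: "\<exists>j. g0 [^] (p ^ j) \<in> Z" by (rule exI)
  define j where "j = (LEAST j. g0 [^] (p ^ j) \<in> Z)"
  have j: "g0 [^] (p ^ j) \<in> Z" unfolding j_def using ex by (rule LeastI_ex)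
  have "j \<noteq> 0" using j g0(2) c by (intro notI) simp
  then obtain i where i: "j = Suc i" by (metis not0_implies_Suc)
  have "g0 [^] (p ^ i) \<notin> Z"
    using not_less_Least[of i "\<lambda>j. g0 [^] (p ^ j) \<in> Z"] i by (simp add: j_def[symmetric])
  moreover have "(g0 [^] (p ^ i)) [^] p \<in> Z" using j c i by (simp add: nat_pow_pow mult.commute)
  moreover have "g0 [^] (p ^ i) \<in> P" using subgroup_nat_pow_closed[OF PD(1) g0(1)] .
  ultimately show thesis using that by blast
qed

text \<open>
  The commutator \<open>c\<close> of \<open>g\<close> and \<open>y\<close> is a power of \<open>g\<close>, because \<open>y\<close> normalizes the subgroup generated by \<open>g\<close>,
  and it lies in \<open>Z\<close>, because \<open>Z\<close> is normal in \<open>P\<close>. But a power of \<open>g\<close> lies in \<open>Z\<close> only if its exponent is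
  divisible by \<open>p\<close>.
\<close>

lemma cnj_eq_mult_p_power:
  assumes y: "y \<in> Z" and g: "g \<in> P" "g \<notin> Z" "g [^] p \<in> Z"
  shows "\<exists>k::nat. cnj G g y = y \<otimes> (g [^] p) [^] k"
proof -
  have yc: "y \<in> carrier G" and gc: "g \<in> carrier G" and yi: "inv y \<in> Z"
    using y g Z_carrier PD(2) Z_subgroup by (auto simp: subgroup.m_inv_closed)
  obtain m :: nat where m: "cnj G (inv y) g = g [^] m" using cnj_Z_power[OF yi g(1)] by blast
  obtain n :: nat where n: "inv g = g [^] n"
  proof -
    have "inv g \<in> generate G {g}" using generate.inv[of g "{g}" G] by simp
    then show thesis using generate_powers[OF gc] that by auto
  qed
  define c where "c = inv y \<otimes> cnj G g y"
  have "c = cnj G (inv y) g \<otimes> inv g" using yc gc by (simp add: c_def cnj_def m_assoc)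
  also have "\<dots> = g [^] (m + n)" unfolding m n using gc by (simp add: nat_pow_mult)
  finally have c: "c = g [^] (m + n)" .
  have "cnj G g y \<in> Z" using conj_Z[OF g(1)] y by blast
  then have "c \<in> Z" unfolding c_def using yi Z_subgroup by (simp add: subgroup.m_closed)
  then have "p dvd m + n" using pow_in_Z_iff[OF gc g(2,3)] c by simp
  then obtain k where "m + n = p * k" by blast
  then have "c = (g [^] p) [^] k" using c gc by (simp add: nat_pow_pow)
  moreover have "cnj G g y = y \<otimes> c" unfolding c_def using yc gc by simp
  ultimately show ?thesis by blast
qed

text \<open>
  If \<open>z\<close> has order \<open>p\<^sup>k\<close>, then \<open>i\<close> to the power \<open>p\<^sup>k\<close> is 1 modulo the order of \<open>y\<close>; by Fermat's theorem
  it is also congruent to \<open>i\<close> modulo \<open>p\<close>.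
\<close>

lemma cnj_power_exponent_cong_1:
  assumes z: "z \<in> P" and y: "y \<in> P" "y \<noteq> \<one>" and i: "cnj G z y = y [^] (i::nat)"
  shows "[i = 1] (mod p)"
proof -
  have zc: "z \<in> carrier G" and yc: "y \<in> carrier G" using z y PD(2) by auto
  have pow: "cnj G (z [^] (m::nat)) y = y [^] (i ^ m)" for m
  proof (induction m)
    case (Suc m)
    have "cnj G (z [^] Suc m) y = cnj G (z [^] m) (cnj G z y)" using zc yc by (simp add: cnj_cnj)
    also have "\<dots> = (y [^] (i ^ m)) [^] i" unfolding i using zc yc Suc by (simp add: cnj_pow)
    finally show ?case using yc by (simp add: nat_pow_pow mult.commute)
  qed (use yc in simp)
  obtain k where k: "ord z = p ^ k" using ord_in_sylow[OF P z] .
  obtain j where j: "ord y = p ^ j" using ord_in_sylow[OF P y(1)] .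
  have "y [^] (i ^ (p ^ k)) = y" using pow[of "p ^ k"] pow_ord_eq_1[OF zc] k yc by simp
  then have "y [^] int (i ^ (p ^ k)) = y [^] (1::int)" unfolding int_pow_int int_pow_1[OF yc] .
  then have "int (ord y) dvd 1 - int (i ^ (p ^ k))" using int_pow_eq[OF yc] by simp
  moreover have "j \<noteq> 0" using j y ord_eq_1[OF yc] by (intro notI) simp
  then have "int p dvd int (ord y)" using j by simp
  ultimately have "int p dvd 1 - int (i ^ (p ^ k))" by (rule dvd_trans[rotated])
  then have "[1 = int (i ^ (p ^ k))] (mod int p)" by (simp only: cong_iff_dvd_diff)
  then have "[1 = i ^ (p ^ k)] (mod p)" by (metis cong_int_iff of_nat_1)
  then show ?thesis using cong_prime_power_exponent[OF p, of i k] by (metis cong_sym cong_trans)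
qed

end

section \<open>The contribution of the norm\<close>

context sylow_character
begin

lemma nu_at_norm_invariant:
  assumes z: "z \<in> Z" and y: "y \<in> P" "y \<noteq> \<one>" and Q: "sylow_subgroup G p Q" "y \<in> Q"
  shows "y \<in> cnj G z ` Q" "[nu_at (cnj G z ` Q) y = nu_at Q y] (mod int p)"
proof -
  have zi: "inv z \<in> Z" and zc: "z \<in> carrier G" and yc: "y \<in> carrier G"
    using z Z_subgroup Z_carrier y PD(2) by (auto simp: subgroup.m_inv_closed)
  obtain i :: nat where i: "cnj G (inv z) y = y [^] i" using cnj_Z_power[OF zi y(1)] by blast
  have yi: "y [^] i \<in> Q" using subgroup_nat_pow_closed[OF sylow_subgroupD(1)[OF Q(1)] Q(2)] .
  have cz: "cnj G z (y [^] i) = y" using cnj_cancel(1)[OF zc yc] i by simp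
  show "y \<in> cnj G z ` Q" using imageI[OF yi, of "cnj G z"] unfolding cz .
  have "[nu_at (cnj G z ` Q) y = nu_at Q (y [^] i)] (mod int p)"
    using nu_at_conj[OF Q(1) yi zc] unfolding cz .
  also have "[nu_at Q (y [^] i) = int i * nu_at Q y] (mod int p)" using Q by (rule nu_at_pow)
  also have "[int i * nu_at Q y = 1 * nu_at Q y] (mod int p)"
  proof (rule cong_mult[OF _ cong_refl])
    have "inv z \<in> P" using zi Z_P by blast
    then have "[i = 1] (mod p)" using cnj_power_exponent_cong_1 y i by blast
    then show "[int i = 1] (mod int p)" by (metis cong_int_iff of_nat_1)
  qed
  finally show "[nu_at (cnj G z ` Q) y = nu_at Q y] (mod int p)" by simp
qed

text \<open>
  \<open>Z\<close> acts on the Sylow subgroups that contain \<open>y\<close>, with constant summand on each orbit; the fixed points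
  are the Sylow subgroups that also contain \<open>Z\<close>.
\<close>

lemma sum_restricts_to_norm:
  assumes y: "y \<in> P" "y \<noteq> \<one>"
  shows "[(\<Sum>Q\<in>{Q\<in>Syl. y \<in> Q}. nu_at Q y) = (\<Sum>Q\<in>{Q\<in>Syl. insert y Z \<subseteq> Q}. nu_at Q y)] (mod int p)"
proof -
  let ?X = "{Q\<in>Syl. y \<in> Q}"
  obtain k where k: "card Z = p ^ k" using card_p_subgroup[OF P Z_subgroup Z_P] .
  have "finite ?X" using finite_Syl by simp
  have "[(\<Sum>Q\<in>?X. nu_at Q y) = (\<Sum>Q\<in>{Q\<in>?X. \<forall>z\<in>Z. cnj G z ` Q = Q}. nu_at Q y)] (mod int p)"
  proof (rule cong_sum_fixed_points[OF p Z_subgroup k \<open>finite ?X\<close>])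
    fix z Q assume z: "z \<in> Z" and "Q \<in> ?X"
    then have Q: "sylow_subgroup G p Q" "y \<in> Q" by auto
    have zc: "z \<in> carrier G" using z Z_carrier by blast
    show "cnj G z ` Q \<in> ?X" using nu_at_norm_invariant(1)[OF z y Q] sylow_conj[OF Q(1) zc] by blast
    show "[nu_at (cnj G z ` Q) y = nu_at Q y] (mod int p)" by (rule nu_at_norm_invariant(2)[OF z y Q])
    fix w assume "w \<in> Z"
    then show "cnj G (z \<otimes> w) ` Q = cnj G z ` cnj G w ` Q"
      using zc Z_carrier sylow_subgroupD(2)[OF Q(1)] by (intro conj_mult) auto
  next
    fix Q assume "Q \<in> ?X"
    then show "cnj G \<one> ` Q = Q" using sylow_subgroupD(2) by (intro conj_one) auto
  qed
  moreover have "{Q\<in>?X. \<forall>z\<in>Z. cnj G z ` Q = Q} = {Q\<in>Syl. insert y Z \<subseteq> Q}"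
  proof (rule Set.set_eqI)
    fix Q
    show "Q \<in> {Q\<in>?X. \<forall>z\<in>Z. cnj G z ` Q = Q} \<longleftrightarrow> Q \<in> {Q\<in>Syl. insert y Z \<subseteq> Q}"
    proof (cases "sylow_subgroup G p Q")
      case True
      then have "(\<forall>z\<in>Z. cnj G z ` Q = Q) \<longleftrightarrow> Z \<subseteq> Q"
        using p_subgroup_normalizing_sylow[OF True Z_subgroup k] conj_self[OF sylow_subgroupD(1)[OF True]]
        by (meson subset_iff)
      then show ?thesis using True by simp
    qed simp
  qed
  ultimately show ?thesis by simp
qed

text \<open>
  For \<open>p = 2\<close>, write \<open>a = g\<^sup>2\<close> and \<open>c = a\<^sup>k\<close> for the commutator of \<open>g\<close> and \<open>y\<close>. The element \<open>g y\<close> gives the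
  same commutator, so \<open>c\<close> is also a power of \<open>(g y)\<^sup>2 = y c a y\<close>, whose value is congruent to that of \<open>c a\<close>. If the value at
  \<open>c\<close> were odd, the first description would make the value at \<open>a\<close> odd; then the value at \<open>c a\<close> is even, and the
  second description makes the value at \<open>c\<close> even.
\<close>

lemma nu_at_commutator_even:
  assumes p2: "p = 2" and Q: "sylow_subgroup G p Q" "Z \<subseteq> Q" and y: "y \<in> Z"
    and g: "g \<in> P" "g \<notin> Z" "g [^] p \<in> Z" and k: "cnj G g y = y \<otimes> (g [^] p) [^] (k::nat)"
  shows "[nu_at Q ((g [^] p) [^] k) = 0] (mod int p)"
proof -
  let ?\<mu> = "nu_at Q"
  have yc: "y \<in> carrier G" and gc: "g \<in> carrier G" using y g Z_carrier PD(2) by auto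
  have m: "[?\<mu> (u \<otimes> v) = ?\<mu> u + ?\<mu> v] (mod int p)" if "u \<in> Z" "v \<in> Z" for u v
    using that Q by (intro nu_at_mult) auto
  define a where "a = g [^] p"
  define c where "c = a [^] k"
  have aZ: "a \<in> Z" using g by (simp add: a_def)
  then have cZ: "c \<in> Z" unfolding c_def by (rule subgroup_nat_pow_closed[OF Z_subgroup])
  have ac: "a \<in> carrier G" "c \<in> carrier G" using aZ cZ Z_carrier by auto
  have gy: "cnj G g y = y \<otimes> c" using k by (simp add: a_def c_def)
  have mc: "[?\<mu> c = int k * ?\<mu> a] (mod int p)" unfolding c_def using Q aZ by (intro nu_at_pow) auto
  let ?h = "g \<otimes> y"
  have h: "?h \<in> P" using g y Z_P PD(1) by (auto intro: subgroup.m_closed)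
  have hZ: "?h \<notin> Z"
  proof
    assume "?h \<in> Z"
    then have "?h \<otimes> inv y \<in> Z" using y Z_subgroup by (simp add: subgroup.m_closed subgroup.m_inv_closed)
    then show False using g(2) yc gc by (simp add: m_assoc)
  qed
  have a2: "a = g \<otimes> g" using gc p2 by (simp add: a_def numeral_2_eq_2)
  have h2: "?h [^] p = (y \<otimes> c) \<otimes> (a \<otimes> y)"
  proof -
    have "?h [^] p = g \<otimes> y \<otimes> (g \<otimes> y)" using gc yc p2 by (simp add: numeral_2_eq_2)
    also have "\<dots> = cnj G g y \<otimes> (a \<otimes> y)" using gc yc by (simp add: a2 cnj_def m_assoc)
    finally show ?thesis by (simp add: gy)
  qed
  have ycZ: "y \<otimes> c \<in> Z" and ayZ: "a \<otimes> y \<in> Z"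
    using y cZ aZ Z_subgroup by (auto intro: subgroup.m_closed)
  then have h2Z: "?h [^] p \<in> Z" unfolding h2 using Z_subgroup by (simp add: subgroup.m_closed)
  obtain l :: nat where l: "cnj G ?h y = y \<otimes> (?h [^] p) [^] l"
    using cnj_eq_mult_p_power[OF y h hZ h2Z] by blast
  have "cnj G ?h y = cnj G g y" using gc yc by (simp add: cnj_cnj) (simp add: cnj_def m_assoc)
  then have "y \<otimes> c = y \<otimes> (?h [^] p) [^] l" using gy l by simp
  then have cl: "c = (?h [^] p) [^] l" using yc gc ac by simp
  have "[?\<mu> (?h [^] p) = ?\<mu> (y \<otimes> c) + ?\<mu> (a \<otimes> y)] (mod int p)" unfolding h2 using ycZ ayZ by (rule m)
  also have "[?\<mu> (y \<otimes> c) + ?\<mu> (a \<otimes> y) = (?\<mu> y + ?\<mu> c) + (?\<mu> a + ?\<mu> y)] (mod int p)"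
    using m[OF y cZ] m[OF aZ y] by (rule cong_add)
  finally have mh: "[?\<mu> (?h [^] p) = (?\<mu> y + ?\<mu> c) + (?\<mu> a + ?\<mu> y)] (mod int p)" .
  have "[?\<mu> c = int l * ?\<mu> (?h [^] p)] (mod int p)"
    unfolding cl using Q h2Z by (intro nu_at_pow) auto
  also have "[int l * ?\<mu> (?h [^] p) = int l * ((?\<mu> y + ?\<mu> c) + (?\<mu> a + ?\<mu> y))] (mod int p)"
    using mh by (rule cong_scalar_left)
  finally have 1: "2 dvd ?\<mu> c - int l * ((?\<mu> y + ?\<mu> c) + (?\<mu> a + ?\<mu> y))"
    using p2 by (simp add: cong_iff_dvd_diff)
  have 2: "2 dvd ?\<mu> c - int k * ?\<mu> a" using mc p2 by (simp add: cong_iff_dvd_diff)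
  have "even (?\<mu> c)" using 1 2 by (auto simp: even_diff_iff)
  then show ?thesis using p2 by (simp add: cong_0_iff c_def a_def)
qed

text \<open>
  With \<open>c\<close> the commutator, the summands are \<open>\<mu>(y) + i \<mu>(c)\<close>, where \<open>\<mu> = \<nu>\<^sub>Q\<close>. They add up to
  \<open>p \<mu>(y) + p (p - 1) / 2 \<mu>(c)\<close>, which vanishes for odd \<open>p\<close>; for \<open>p = 2\<close>, the value \<open>\<mu>(c)\<close> itself is even.
\<close>

lemma sum_over_conjugates_vanishes:
  assumes Q: "sylow_subgroup G p Q" "Z \<subseteq> Q" and y: "y \<in> Z"
    and g: "g \<in> P" "g \<notin> Z" "g [^] p \<in> Z"
  shows "[(\<Sum>i<p. nu_at Q (cnj G (g [^] i) y)) = 0] (mod int p)"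
proof -
  let ?\<mu> = "nu_at Q"
  have yc: "y \<in> carrier G" and gc: "g \<in> carrier G" using y g Z_carrier PD(2) by auto
  obtain k :: nat where k: "cnj G g y = y \<otimes> (g [^] p) [^] k" using cnj_eq_mult_p_power[OF y g] by blast
  define c where "c = (g [^] p) [^] k"
  have cZ: "c \<in> Z" unfolding c_def using g(3) by (rule subgroup_nat_pow_closed[OF Z_subgroup])
  have cc: "c \<in> carrier G" using cZ Z_carrier by blast
  have gcc: "cnj G g c = c"
  proof -
    have "g \<otimes> c = c \<otimes> g"
      using gc unfolding c_def nat_pow_pow[OF gc] by (simp add: nat_pow_comm[of g 1, simplified])
    then show ?thesis using gc cc by (simp add: cnj_def m_assoc)
  qed
  have pow: "cnj G (g [^] (i::nat)) y = y \<otimes> c [^] i" for i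
  proof (induction i)
    case (Suc i)
    have gS: "g [^] Suc i = g \<otimes> g [^] i" and cS: "c [^] Suc i = c \<otimes> c [^] i"
      using nat_pow_Suc2 gc cc by blast+
    have "cnj G (g [^] Suc i) y = cnj G g (cnj G (g [^] i) y)"
      unfolding gS using gc yc by (intro cnj_cnj) auto
    also have "\<dots> = y \<otimes> c \<otimes> c [^] i" unfolding Suc using gc yc cc k gcc by (simp add: cnj_mult cnj_pow c_def[symmetric])
    finally show ?case unfolding cS using yc cc by (simp add: m_assoc)
  qed (use yc in simp)
  have tm: "[?\<mu> (cnj G (g [^] i) y) = ?\<mu> y + int i * ?\<mu> c] (mod int p)" for i :: nat
  proof -
    have "c [^] i \<in> Z" using cZ by (rule subgroup_nat_pow_closed[OF Z_subgroup])
    then have "[?\<mu> (y \<otimes> c [^] i) = ?\<mu> y + ?\<mu> (c [^] i)] (mod int p)" using Q y by (intro nu_at_mult) auto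
    also have "[?\<mu> y + ?\<mu> (c [^] i) = ?\<mu> y + int i * ?\<mu> c] (mod int p)"
      using Q cZ by (intro cong_add nu_at_pow) auto
    finally show ?thesis by (simp only: pow)
  qed
  have "[(\<Sum>i<p. ?\<mu> (cnj G (g [^] i) y)) = (\<Sum>i<p. ?\<mu> y + int i * ?\<mu> c)] (mod int p)"
    using tm by (rule cong_sum)
  also have "(\<Sum>i<p. ?\<mu> y + int i * ?\<mu> c) = int p * ?\<mu> y + (\<Sum>i<p. int i) * ?\<mu> c"
    by (simp add: sum.distrib sum_distrib_right)
  also have "[int p * ?\<mu> y + (\<Sum>i<p. int i) * ?\<mu> c = 0] (mod int p)"
  proof (cases "p = 2")
    case True
    then have "[?\<mu> c = 0] (mod int p)"
      unfolding c_def using nu_at_commutator_even[OF _ Q y g k] by blast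
    then show ?thesis by (simp add: cong_0_iff)
  next
    case False
    then have "odd p" using p by (metis prime_odd_nat prime_ge_2_nat order_le_less)
    have "2 * (\<Sum>i<p. int i) = int p * (int p - 1)"
    proof -
      have "2 * (\<Sum>i<n. int i) = int n * (int n - 1)" for n by (induction n) (auto simp: algebra_simps)
      then show ?thesis .
    qed
    then have "int p dvd 2 * (\<Sum>i<p. int i)" by simp
    moreover have "coprime (int p) 2" using \<open>odd p\<close> by simp
    ultimately have "int p dvd (\<Sum>i<p. int i)" by (simp add: coprime_dvd_mult_right_iff)
    then show ?thesis by (simp add: cong_0_iff)
  qed
  finally show ?thesis .
qed

text \<open>
  An element \<open>w \<in> P\<close> that is of order \<open>p\<close> modulo \<open>Z\<close> permutes the Sylow subgroups \<open>Q\<close> with \<open>P \<inter> Q = Z\<close> in cycles of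
  length exactly \<open>p\<close>, because a power of \<open>w\<close> that normalizes \<open>Q\<close> lies in \<open>P \<inter> Q\<close>. Transporting the character
  back to one member of the cycle turns the sum over the cycle into a sum over conjugates of \<open>y\<close> in \<open>Z\<close>.
\<close>

lemma sum_over_meeting_in_norm:
  assumes Zne: "Z \<noteq> P" and y: "y \<in> Z"
  shows "[(\<Sum>Q\<in>{Q\<in>Syl. P \<inter> Q = Z}. nu_at Q y - \<nu> y) = 0] (mod int p)"
proof -
  let ?X = "{Q\<in>Syl. P \<inter> Q = Z}"
  obtain w where w: "w \<in> P" "w \<notin> Z" "w [^] p \<in> Z" using exists_order_p_mod_Z[OF Zne] .
  have wc: "w \<in> carrier G" and yc: "y \<in> carrier G" using w y PD(2) Z_carrier by auto
  \<comment> \<open>Moving \<open>Q\<close> by \<open>w\<^sup>i\<close> amounts to conjugating \<open>y\<close> by the inverse of \<open>w\<^sup>i\<close>.\<close>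
  define g where "g = inv w"
  have gp: "g [^] p = inv (w [^] p)" using wc by (simp add: g_def nat_pow_inv)
  have g: "g \<in> P" "g \<notin> Z" "g [^] p \<in> Z" unfolding gp
    using w wc PD(1) Z_subgroup by (auto simp: g_def subgroup.m_inv_closed dest: subgroup.m_inv_closed)
  have pow_norm: "p dvd n" if Q: "Q \<in> ?X" and "cnj G (w [^] n) ` Q = Q" for Q n
  proof -
    have Qs: "sylow_subgroup G p Q" "P \<inter> Q = Z" using Q by auto
    have wn: "w [^] n \<in> P" using subgroup_nat_pow_closed[OF PD(1) w(1)] .
    obtain k where "ord (w [^] n) = p ^ k" using ord_in_sylow[OF P wn] .
    then have "w [^] n \<in> Q" using p_element_normalizing_sylow[OF Qs(1)] that(2) wc by blast
    then have "w [^] n \<in> Z" using wn Qs(2) by blast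
    then show ?thesis using pow_in_Z_iff[OF wc w(2,3)] by simp
  qed
  have closed: "cnj G w ` Q \<in> ?X" if "Q \<in> ?X" for Q
  proof -
    have Q: "sylow_subgroup G p Q" "P \<inter> Q = Z" using that by auto
    have "P \<inter> cnj G w ` Q = cnj G w ` P \<inter> cnj G w ` Q" using conj_self[OF PD(1) w(1)] by simp
    also have "\<dots> = cnj G w ` Z" using conj_Int[OF wc PD(2) sylow_subgroupD(2)[OF Q(1)]] Q(2) by simp
    also have "\<dots> = Z" using w(1) by (rule conj_Z)
    finally show ?thesis using sylow_conj[OF Q(1) wc] by simp
  qed
  have "[(\<Sum>Q\<in>?X. nu_at Q y - \<nu> y) = (\<Sum>Q\<in>{Q\<in>?X. cnj G w ` Q = Q}. nu_at Q y - \<nu> y)] (mod int p)"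
  proof (rule cong_sum_cycles[OF wc])
    show "finite ?X" using finite_Syl by simp
    show "Q \<subseteq> carrier G" if "Q \<in> ?X" for Q using that sylow_subgroupD(2) by auto
    show "cnj G w ` Q \<in> ?X" if "Q \<in> ?X" for Q using that by (rule closed)
    fix Q and r :: nat
    assume QX: "Q \<in> ?X" and ne: "cnj G w ` Q \<noteq> Q" and r: "r > 0"
      and per: "\<And>n. cnj G (w [^] n) ` Q = Q \<longleftrightarrow> r dvd n"
    have Q: "sylow_subgroup G p Q" "P \<inter> Q = Z" using QX by auto
    then have ZQ: "Z \<subseteq> Q" by blast
    have "w [^] p \<in> Q" using w(3) ZQ by blast
    then have "cnj G (w [^] p) ` Q = Q" by (rule conj_self[OF sylow_subgroupD(1)[OF Q(1)]])
    then have "r dvd p" using per by simp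
    moreover have "r \<noteq> 1" using per[of 1] ne wc by auto
    ultimately have rp: "r = p" using p by (metis prime_nat_iff)
    have eq: "[nu_at (cnj G (w [^] i) ` Q) y = nu_at Q (cnj G (g [^] i) y)] (mod int p)" for i :: nat
    proof -
      have gi: "g [^] i = inv (w [^] i)" using wc by (simp add: g_def nat_pow_inv)
      have "g [^] i \<in> P" using subgroup_nat_pow_closed[OF PD(1) g(1)] .
      then have "cnj G (g [^] i) y \<in> Q" using conj_Z y ZQ by blast
      moreover have "cnj G (w [^] i) (cnj G (g [^] i) y) = y" unfolding gi using wc yc by simp
      ultimately show ?thesis using nu_at_conj[OF Q(1), of "cnj G (g [^] i) y" "w [^] i"] wc by simp
    qed
    have "[(\<Sum>i<p. nu_at (cnj G (w [^] i) ` Q) y - \<nu> y) = (\<Sum>i<p. nu_at Q (cnj G (g [^] i) y) - \<nu> y)] (mod int p)"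
      using eq by (intro cong_sum cong_diff) auto
    also have "(\<Sum>i<p. nu_at Q (cnj G (g [^] i) y) - \<nu> y) = (\<Sum>i<p. nu_at Q (cnj G (g [^] i) y)) - int p * \<nu> y"
      by (simp add: sum_subtractf)
    also have "[(\<Sum>i<p. nu_at Q (cnj G (g [^] i) y)) - int p * \<nu> y = 0 - 0] (mod int p)"
      using sum_over_conjugates_vanishes[OF Q(1) ZQ y g] by (rule cong_diff) (simp add: cong_0_iff)
    finally show "[(\<Sum>i<r. nu_at (cnj G (w [^] i) ` Q) y - \<nu> y) = 0] (mod int p)" by (simp add: rp)
  qed
  moreover have "{Q\<in>?X. cnj G w ` Q = Q} = {}"
  proof -
    have "cnj G w ` Q \<noteq> Q" if "Q \<in> ?X" for Q
      using pow_norm[OF that, of 1] wc p by (auto simp: prime_nat_iff)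
    then show ?thesis by blast
  qed
  ultimately show ?thesis by (simp only: sum.empty)
qed

text \<open>
  The differences \<open>\<nu>\<^sub>Q(y) - \<nu>(y)\<close>, summed over the Sylow subgroups \<open>Q\<close> containing \<open>y\<close> and \<open>Z\<close>, add up to zero:
  each one vanishes if \<open>P \<inter> Q\<close> is larger than \<open>Z\<close> or \<open>Z = P\<close>, and the others cancel in cycles. As the number of
  these \<open>Q\<close> is congruent to 1, the sum of the \<open>\<nu>\<^sub>Q(y)\<close>, which is zero, equals \<open>\<nu>(y)\<close>.
\<close>

lemma character_vanishes:
  assumes nil: "\<And>Q. \<lbrakk>sylow_subgroup G p Q; tame_intersection G p P Q; Z \<subset> P \<inter> Q; P \<inter> Q \<subset> P\<rbrakk>
           \<Longrightarrow> p_nilpotent p (G\<lparr>carrier := normalizer G (P \<inter> Q)\<rparr>)"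
    and V: "\<And>g. g \<in> carrier G \<Longrightarrow> [(\<Sum>Q\<in>Syl. \<nu> (transfer_factor g Q)) = 0] (mod int p)"
    and n: "n \<in> N"
  shows "[\<nu> n = 0] (mod int p)"
proof (rule ccontr)
  assume "\<not> ?thesis"
  then have "\<exists>y. y \<in> P \<and> \<not> [\<nu> y = 0] (mod int p)" using nonzero_on_sylow n by blast
  then obtain y where y: "y \<in> P" "\<not> [\<nu> y = 0] (mod int p)"
    and least: "\<And>u. u \<in> P \<and> \<not> [\<nu> u = 0] (mod int p) \<Longrightarrow> ord y \<le> ord u"
    using ex_has_least_nat[of "\<lambda>y. y \<in> P \<and> \<not> [\<nu> y = 0] (mod int p)" _ ord] by blast
  have min: "[\<nu> u = 0] (mod int p)" if "u \<in> P" "ord u < ord y" for u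
    using least[of u] that by force
  have y1: "y \<noteq> \<one>" using y(2) nu_one by blast
  let ?T = "{Q\<in>Syl. insert y Z \<subseteq> Q}" and ?X = "{Q\<in>Syl. P \<inter> Q = Z}"
  have finT: "finite ?T" using finite_Syl by simp
  have "y \<in> carrier G" using y(1) PD(2) by blast
  then have "[(\<Sum>Q\<in>{Q\<in>Syl. y \<in> Q}. nu_at Q y) = 0] (mod int p)"
    using transfer_at_minimal[OF y(1) min V] by blast
  then have T0: "[(\<Sum>Q\<in>?T. nu_at Q y) = 0] (mod int p)"
    using cong_trans[OF cong_sym[OF sum_restricts_to_norm[OF y(1) y1]]] by blast
  have large: "[nu_at Q y - \<nu> y = 0] (mod int p)" if Q: "Q \<in> ?T" "P \<inter> Q \<noteq> Z \<or> Z = P" for Q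
  proof -
    have Qs: "sylow_subgroup G p Q" "y \<in> Q" "Z \<subseteq> P \<inter> Q" using Q Z_P by auto
    have "[nu_at Q y = \<nu> y] (mod int p)"
    proof (cases "P \<inter> Q = P")
      case True
      then have "Q = P" using card_subset_eq[OF sylow_subgroupD(3)[OF Qs(1)], of P] PD(4) sylow_subgroupD(4)[OF Qs(1)] by auto
      moreover have "P = cnj G \<one> ` P" using PD(2) by simp
      ultimately show ?thesis using Qs(2) y(1) \<open>y \<in> carrier G\<close> by (intro nu_at_centralizer[of \<one>]) auto
    next
      case False
      then have "Z \<subset> P \<inter> Q" using Qs Q(2) by blast
      then have "\<exists>c\<in>carrier G. (\<forall>d\<in>P \<inter> Q. cnj G c d = d) \<and> Q = cnj G c ` P"
        using Qs(1) by (intro sylow_conjugate_in_centralizer[OF P nil])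
      then obtain c where c: "c \<in> carrier G" "\<forall>d\<in>P \<inter> Q. cnj G c d = d" "Q = cnj G c ` P" by blast
      then have "cnj G c y = y" using Qs(2) y(1) by blast
      then show ?thesis using nu_at_centralizer[OF c(1,3) _ Qs(2) y(1)] by simp
    qed
    then show ?thesis by (simp add: cong_iff_dvd_diff)
  qed
  have "[(\<Sum>Q\<in>?T. nu_at Q y - \<nu> y) = 0] (mod int p)"
  proof (cases "y \<in> Z \<and> Z \<noteq> P")
    case True
    then have XT: "?X \<subseteq> ?T" by auto
    have "(\<Sum>Q\<in>?T. nu_at Q y - \<nu> y) = (\<Sum>Q\<in>?T - ?X. nu_at Q y - \<nu> y) + (\<Sum>Q\<in>?X. nu_at Q y - \<nu> y)"
      using sum.subset_diff[OF XT finT] .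
    moreover have "[(\<Sum>Q\<in>?T - ?X. nu_at Q y - \<nu> y) = (\<Sum>Q\<in>?T - ?X. 0)] (mod int p)"
      by (rule cong_sum) (use large in auto)
    moreover have "[(\<Sum>Q\<in>?X. nu_at Q y - \<nu> y) = 0] (mod int p)"
      using sum_over_meeting_in_norm True by blast
    ultimately show ?thesis using cong_add by fastforce
  next
    case False
    have "[(\<Sum>Q\<in>?T. nu_at Q y - \<nu> y) = (\<Sum>Q\<in>?T. 0)] (mod int p)"
    proof (rule cong_sum)
      fix Q assume Q: "Q \<in> ?T"
      then have "y \<in> P \<inter> Q" using y(1) by auto
      then have "P \<inter> Q \<noteq> Z \<or> Z = P" using False by blast
      with Q show "[nu_at Q y - \<nu> y = 0] (mod int p)" by (rule large)
    qed
    then show ?thesis by simp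
  qed
  then have "int p dvd (\<Sum>Q\<in>?T. nu_at Q y) - int (card ?T) * \<nu> y"
    by (simp add: sum_subtractf cong_0_iff)
  then have "[(\<Sum>Q\<in>?T. nu_at Q y) = int (card ?T) * \<nu> y] (mod int p)" by (simp only: cong_iff_dvd_diff)
  moreover have "[int (card ?T) * \<nu> y = 1 * \<nu> y] (mod int p)"
    using card_Syl_containing[OF P, of "insert y Z"] y(1) Z_P by (intro cong_mult) auto
  ultimately have "[\<nu> y = 0] (mod int p)"
    using T0 by (metis (no_types, lifting) cong_sym cong_trans mult_1)
  then show False using y(2) by blast
qed

end

section \<open>Control of transfer\<close>

theorem theorem1p8:
  fixes G :: "('a, 'b) monoid_scheme" and p :: nat and P :: "'a set"
  assumes "group G" and "finite (carrier G)"
    and "prime p" and "p dvd order G"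
    and "sylow_subgroup G p P"
    and "\<And>Q. \<lbrakk>sylow_subgroup G p Q; tame_intersection G p P Q;
               group_norm (G\<lparr>carrier := P\<rparr>) \<subset> P \<inter> Q; P \<inter> Q \<subset> P\<rbrakk>
           \<Longrightarrow> p_nilpotent p (G\<lparr>carrier := normalizer G (P \<inter> Q)\<rparr>)"
  shows "controls_p_transfer G p (normalizer G P)"
proof (rule ccontr)
  assume contra: "\<not> ?thesis"
  interpret T: sylow_transfer G p P
    using assms(1,2,3,5)
    by (simp add: sylow_transfer_def sylow_transfer_axioms_def finite_group_prime_def finite_group_prime_axioms_def)
  obtain \<nu> n where \<nu>: "additive_mod p (G\<lparr>carrier := normalizer G P\<rparr>) \<nu>"
      "n \<in> normalizer G P" "\<not> [\<nu> n = 0] (mod int p)"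
      "\<And>g. g \<in> carrier G \<Longrightarrow> [(\<Sum>Q\<in>{Q. sylow_subgroup G p Q}. \<nu> (T.transfer_factor g Q)) = 0] (mod int p)"
    using T.character_with_trivial_transfer[OF contra] by blast
  interpret C: sylow_character G p P \<nu>
    using \<nu>(1) by (simp add: sylow_character_def sylow_character_axioms_def T.sylow_transfer_axioms)
  show False using C.character_vanishes[OF assms(6) \<nu>(4,2)] \<nu>(3) by blast
qed

end
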